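(* Let $G$ be a profinite group and let $A$ be a discrete $G$-module. Let $\mathcal{U}$ be the set of all open normal subgroups of $G$, directed by declaring $V\le U$ if and only if $U\subseteq V$. Then for every $n\ge 0$ the symmetric continuous cohomology of $G$ with coefficients in $A$ equals the direct limit of the symmetric cohomology of the finite groups $G/U$ with coefficients in $A^U$, i.e. there is an isomorphism $$HS_c^n(G,A)\;\cong\;\varinjlim_{U\in\mathcal{U}}HS^n(G/U,A^U).$$
   Context: A topological $G$-module is an abelian topological group $A$ (written additively) with a continuous action $G\times A\to A$ by group automorphisms; a discrete $G$-module is one where $A$ has the discrete topology. Symmetric continuous cohomology. For a topological group $G$, a topological $G$-module $A$ and $n\ge 0$ let $C_c^n(G,A)$ be the abelian group of all continuous maps $G^n\to A$, with coboundary $$\partial^n(\sigma)(g_1,\dots,g_{n+1})=g_1\sigma(g_2,\dots,g_{n+1})+\sum_{i=1}^n(-1)^i\sigma(g_1,\dots,g_ig_{i+1},\dots,g_{n+1})+(-1)^{n+1}\sigma(g_1,\dots,g_n).$$ The symmetric group $\Sigma_{n+1}$ acts on $C_c^n(G,A)$; the action is determined by the adjacent transpositions $\tau_i=(i,i+1)$, $1\le i\le n$. For $n=1$: $(\tau_1\sigma)(g)=-g\,\sigma(g^{-1})$. For $n\ge 2$: $$(\tau_1\sigma)(g_1,\dots,g_n)=-g_1\sigma(g_1^{-1},g_1g_2,g_3,\dots,g_n),$$ $$(\tau_i\sigma)(g_1,\dots,g_n)=-\sigma(g_1,\dots,g_{i-2},g_{i-1}g_i,g_i^{-1},g_ig_{i+1},g_{i+2},\dots,g_n)\quad(1<i<n),$$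 $$(\tau_n\sigma)(g_1,\dots,g_n)=-\sigma(g_1,\dots,g_{n-2},g_{n-1}g_n,g_n^{-1}).$$ This action is compatible with the coboundaries, so the invariants $CS_c^n(G,A)=C_c^n(G,A)^{\Sigma_{n+1}}$ form a subcomplex; $HS_c^n(G,A)$ is the $n$-th cohomology group of this subcomplex. For an abstract group $G$ and a $G$-module $A$, $CS^n(G,A)$ and $HS^n(G,A)$ (symmetric cohomology) are defined by the same formulas with all maps $G^n\to A$ instead of continuous ones. Direct system. For $U\in\mathcal{U}$ the group $G/U$ is finite and $A^U=\{a\in A: ua=a\ \text{for all}\ u\in U\}$ is a $G/U$-module via $(gU)a=ga$. For $V\le U$ (i.e. $U\subseteq V$), let $\alpha_{UV}:G/U\to G/V$ be the canonical projection and $\beta_{VU}:A^V\hookrightarrow A^U$ the inclusion. The transition map $HS^n(G/V,A^V)\to HS^n(G/U,A^U)$ is induced by the cochain map $CS^n(G/V,A^V)\to CS^n(G/U,A^U)$, $\sigma\mapsto\beta_{VU}\circ\sigma\circ(\alpha_{UV})^{n}$, where $(\alpha_{UV})^n$ is the $n$-fold product map. *)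

theory Defs
  imports "HOL-Analysis.Analysis" "HOL-Algebra.Algebra"
begin

section \<open>Profinite groups and discrete modules\<close>

locale topological_group = group G for G :: "('a, 'm) monoid_scheme" (structure) +
  fixes T :: "'a topology"
  assumes topspace_eq_carrier: "topspace T = carrier G"
    and continuous_mult: "continuous_map (prod_topology T T) T (\<lambda>(x, y). x \<otimes> y)"
    and continuous_inv: "continuous_map T T (\<lambda>x. inv x)"

definition totally_disconnected_space :: "'a topology \<Rightarrow> bool" where
  "totally_disconnected_space T \<longleftrightarrow> (\<forall>C. connectedin T C \<longrightarrow> (\<exists>x. C \<subseteq> {x}))"

locale profinite_group = topological_group +
  assumes compact: "compact_space T"
    and Hausdorff: "Hausdorff_space T"
    and totally_disconnected: "totally_disconnected_space T"

text \<open>Abelian groups are \<open>comm_group\<close> structures, so the group operation of a module is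
  written multiplicatively throughout: \<open>\<otimes>\<close>, \<open>inv\<close> and \<open>[^]\<close> stand for addition, negation and
  integer multiples.\<close>

locale topological_module =
  G?: topological_group G T + A?: comm_group A + A?: topological_group A TA
  for G :: "('a, 'm) monoid_scheme" (structure) and T :: "'a topology"
    and A :: "('b, 'k) monoid_scheme" (structure) and TA :: "'b topology" +
  fixes act :: "'a \<Rightarrow> 'b \<Rightarrow> 'b"
  assumes act_hom: "act \<in> hom G (AutoGroup A)"
    and continuous_act: "continuous_map (prod_topology T TA) TA (\<lambda>(g, a). act g a)"

locale discrete_module = topological_module +
  assumes discrete: "TA = discrete_topology (carrier A)"


section \<open>Cochains\<close>

text \<open>A tuple \<open>(g\<^sub>1, \<dots>, g\<^sub>n)\<close> is an extensional function on \<open>{1..n}\<close>.\<close>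

definition tuples :: "('a, 'm) monoid_scheme \<Rightarrow> nat \<Rightarrow> (nat \<Rightarrow> 'a) set" where
  "tuples G n = (\<Pi>\<^sub>E j\<in>{1..n}. carrier G)"

definition cochains ::
  "('a, 'm) monoid_scheme \<Rightarrow> ('b, 'k) monoid_scheme \<Rightarrow> nat \<Rightarrow> ((nat \<Rightarrow> 'a) \<Rightarrow> 'b) set" where
  "cochains G A n = (\<Pi>\<^sub>E g\<in>tuples G n. carrier A)"

definition cont_cochains ::
  "('a, 'm) monoid_scheme \<Rightarrow> 'a topology \<Rightarrow> ('b, 'k) monoid_scheme \<Rightarrow> 'b topology \<Rightarrow>
    nat \<Rightarrow> ((nat \<Rightarrow> 'a) \<Rightarrow> 'b) set" where
  "cont_cochains G T A TA n =
    {\<sigma> \<in> cochains G A n. continuous_map (product_topology (\<lambda>j. T) {1..n}) TA \<sigma>}"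

text \<open>\<open>face G n i\<close> sends an \<open>(n+1)\<close>-tuple to the \<open>n\<close>-tuple on which \<open>\<sigma>\<close> is evaluated in the
  \<open>i\<close>-th summand of the coboundary: \<open>(g\<^sub>2, \<dots>, g\<^sub>n\<^sub>+\<^sub>1)\<close> for \<open>i = 0\<close>,
  \<open>(g\<^sub>1, \<dots>, g\<^sub>i g\<^sub>i\<^sub>+\<^sub>1, \<dots>, g\<^sub>n\<^sub>+\<^sub>1)\<close> for \<open>1 \<le> i \<le> n\<close>, and \<open>(g\<^sub>1, \<dots>, g\<^sub>n)\<close> for \<open>i = n + 1\<close>.\<close>

definition face ::
  "('a, 'm) monoid_scheme \<Rightarrow> nat \<Rightarrow> nat \<Rightarrow> (nat \<Rightarrow> 'a) \<Rightarrow> (nat \<Rightarrow> 'a)" where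
  "face G n i g = (\<lambda>j\<in>{1..n}.
     if j < i then g j
     else if j = i then g j \<otimes>\<^bsub>G\<^esub> g (j + 1)
     else g (j + 1))"

definition coboundary ::
  "('a, 'm) monoid_scheme \<Rightarrow> ('b, 'k) monoid_scheme \<Rightarrow> ('a \<Rightarrow> 'b \<Rightarrow> 'b) \<Rightarrow>
    nat \<Rightarrow> ((nat \<Rightarrow> 'a) \<Rightarrow> 'b) \<Rightarrow> ((nat \<Rightarrow> 'a) \<Rightarrow> 'b)" where
  "coboundary G A act n \<sigma> = (\<lambda>g\<in>tuples G (n + 1).
     act (g 1) (\<sigma> (face G n 0 g))
     \<otimes>\<^bsub>A\<^esub> finprod A (\<lambda>i. \<sigma> (face G n i g) [^]\<^bsub>A\<^esub> ((- 1) ^ i :: int)) {1..n}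
     \<otimes>\<^bsub>A\<^esub> \<sigma> (face G n (n + 1) g) [^]\<^bsub>A\<^esub> ((- 1) ^ (n + 1) :: int))"


section \<open>The action of the symmetric group\<close>

text \<open>\<open>adj_args G n i\<close> is the change of variables in \<open>\<tau>\<^sub>i\<close>: it replaces the entries
  \<open>g\<^sub>i\<^sub>-\<^sub>1, g\<^sub>i, g\<^sub>i\<^sub>+\<^sub>1\<close>, as far as their indices lie in \<open>{1..n}\<close>, by
  \<open>g\<^sub>i\<^sub>-\<^sub>1 g\<^sub>i, g\<^sub>i\<inverse>, g\<^sub>i g\<^sub>i\<^sub>+\<^sub>1\<close>. This treats the cases \<open>i = 1\<close>, \<open>1 < i < n\<close>, \<open>i = n\<close>
  (and \<open>n = 1\<close>) uniformly; the factor \<open>g\<^sub>1\<close> acting on the value occurs for \<open>i = 1\<close> only.\<close>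

definition adj_args ::
  "('a, 'm) monoid_scheme \<Rightarrow> nat \<Rightarrow> nat \<Rightarrow> (nat \<Rightarrow> 'a) \<Rightarrow> (nat \<Rightarrow> 'a)" where
  "adj_args G n i g = (\<lambda>j\<in>{1..n}.
     if j + 1 = i then g j \<otimes>\<^bsub>G\<^esub> g i
     else if j = i then inv\<^bsub>G\<^esub> (g i)
     else if j = i + 1 then g i \<otimes>\<^bsub>G\<^esub> g j
     else g j)"

definition adj_act ::
  "('a, 'm) monoid_scheme \<Rightarrow> ('b, 'k) monoid_scheme \<Rightarrow> ('a \<Rightarrow> 'b \<Rightarrow> 'b) \<Rightarrow>
    nat \<Rightarrow> nat \<Rightarrow> ((nat \<Rightarrow> 'a) \<Rightarrow> 'b) \<Rightarrow> ((nat \<Rightarrow> 'a) \<Rightarrow> 'b)" where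
  "adj_act G A act n i \<sigma> = (\<lambda>g\<in>tuples G n.
     inv\<^bsub>A\<^esub> (if i = 1 then act (g 1) (\<sigma> (adj_args G n i g)) else \<sigma> (adj_args G n i g)))"

text \<open>\<open>sym_act G A act n \<pi> \<sigma> \<sigma>'\<close> says that \<open>\<pi> \<in> \<Sigma>\<^sub>n\<^sub>+\<^sub>1\<close>, as a permutation of \<open>{1..n+1}\<close>, sends
  \<open>\<sigma>\<close> to \<open>\<sigma>'\<close>. It is the graph of the action generated by
  \<open>\<tau>\<^sub>i = (i, i+1) \<mapsto> adj_act G A act n i\<close>; every permutation of \<open>{1..n+1}\<close> is reached since the
  adjacent transpositions generate.\<close>

inductive sym_act ::
  "('a, 'm) monoid_scheme \<Rightarrow> ('b, 'k) monoid_scheme \<Rightarrow> ('a \<Rightarrow> 'b \<Rightarrow> 'b) \<Rightarrow> nat \<Rightarrow>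
    (nat \<Rightarrow> nat) \<Rightarrow> ((nat \<Rightarrow> 'a) \<Rightarrow> 'b) \<Rightarrow> ((nat \<Rightarrow> 'a) \<Rightarrow> 'b) \<Rightarrow> bool"
  for G A act n where
  one: "sym_act G A act n id \<sigma> \<sigma>"
| adj: "sym_act G A act n \<pi> \<sigma> \<sigma>' \<Longrightarrow> i \<in> {1..n} \<Longrightarrow>
    sym_act G A act n (Transposition.transpose i (i + 1) \<circ> \<pi>) \<sigma> (adj_act G A act n i \<sigma>')"

lemma sym_invariant_iff:
  "(\<forall>\<pi>. \<pi> permutes {1..n + 1} \<longrightarrow> (\<forall>\<sigma>'. sym_act G A act n \<pi> \<sigma> \<sigma>' \<longrightarrow> \<sigma>' = \<sigma>)) \<longleftrightarrow>
   (\<forall>i\<in>{1..n}. adj_act G A act n i \<sigma> = \<sigma>)" (is "?L \<longleftrightarrow> ?R")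
proof
  assume L: ?L
  show ?R
  proof
    fix i assume i: "i \<in> {1..n}"
    then have "Transposition.transpose i (i + 1) \<circ> id permutes {1..n + 1}"
      by (auto intro!: permutes_swap_id)
    with L sym_act.adj[OF sym_act.one i] show "adj_act G A act n i \<sigma> = \<sigma>"
      by blast
  qed
next
  assume R: ?R
  have "\<sigma>' = \<sigma>" if "sym_act G A act n \<pi> \<sigma> \<sigma>'" for \<pi> \<sigma>'
    using that
  proof (induction \<pi> \<sigma> \<equiv> \<sigma> \<sigma>')
    case one
    show ?case by (rule refl)
  next
    case (adj \<pi> \<sigma>' i)
    with R show ?case by simp
  qed
  then show ?L by blast
qed


section \<open>Symmetric cohomology\<close>

text \<open>The parameter \<open>C\<close> is the family of all cochains or that of the continuous ones.\<close>

definition sym_cochains ::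
  "('a, 'm) monoid_scheme \<Rightarrow> ('b, 'k) monoid_scheme \<Rightarrow> ('a \<Rightarrow> 'b \<Rightarrow> 'b) \<Rightarrow>
    (nat \<Rightarrow> ((nat \<Rightarrow> 'a) \<Rightarrow> 'b) set) \<Rightarrow> nat \<Rightarrow> ((nat \<Rightarrow> 'a) \<Rightarrow> 'b) monoid" where
  "sym_cochains G A act C n =
    \<lparr>carrier = {\<sigma> \<in> C n. \<forall>\<pi>. \<pi> permutes {1..n + 1} \<longrightarrow>
                   (\<forall>\<sigma>'. sym_act G A act n \<pi> \<sigma> \<sigma>' \<longrightarrow> \<sigma>' = \<sigma>)},
     monoid.mult = (\<lambda>\<sigma> \<tau>. \<lambda>g\<in>tuples G n. \<sigma> g \<otimes>\<^bsub>A\<^esub> \<tau> g),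
     one = (\<lambda>g\<in>tuples G n. \<one>\<^bsub>A\<^esub>)\<rparr>"

definition sym_cocycles ::
  "('a, 'm) monoid_scheme \<Rightarrow> ('b, 'k) monoid_scheme \<Rightarrow> ('a \<Rightarrow> 'b \<Rightarrow> 'b) \<Rightarrow>
    (nat \<Rightarrow> ((nat \<Rightarrow> 'a) \<Rightarrow> 'b) set) \<Rightarrow> nat \<Rightarrow> ((nat \<Rightarrow> 'a) \<Rightarrow> 'b) monoid" where
  "sym_cocycles G A act C n = (sym_cochains G A act C n)
    \<lparr>carrier := kernel (sym_cochains G A act C n) (sym_cochains G A act C (n + 1))
                  (coboundary G A act n)\<rparr>"

definition sym_coboundaries ::
  "('a, 'm) monoid_scheme \<Rightarrow> ('b, 'k) monoid_scheme \<Rightarrow> ('a \<Rightarrow> 'b \<Rightarrow> 'b) \<Rightarrow>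
    (nat \<Rightarrow> ((nat \<Rightarrow> 'a) \<Rightarrow> 'b) set) \<Rightarrow> nat \<Rightarrow> ((nat \<Rightarrow> 'a) \<Rightarrow> 'b) set" where
  "sym_coboundaries G A act C n = (case n of
      0 \<Rightarrow> {\<one>\<^bsub>sym_cochains G A act C 0\<^esub>}
    | Suc m \<Rightarrow> coboundary G A act m ` carrier (sym_cochains G A act C m))"

definition sym_cohomology ::
  "('a, 'm) monoid_scheme \<Rightarrow> ('b, 'k) monoid_scheme \<Rightarrow> ('a \<Rightarrow> 'b \<Rightarrow> 'b) \<Rightarrow>
    (nat \<Rightarrow> ((nat \<Rightarrow> 'a) \<Rightarrow> 'b) set) \<Rightarrow> nat \<Rightarrow> ((nat \<Rightarrow> 'a) \<Rightarrow> 'b) set monoid" where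
  "sym_cohomology G A act C n = sym_cocycles G A act C n Mod sym_coboundaries G A act C n"

definition HS ::
  "('a, 'm) monoid_scheme \<Rightarrow> ('b, 'k) monoid_scheme \<Rightarrow> ('a \<Rightarrow> 'b \<Rightarrow> 'b) \<Rightarrow>
    nat \<Rightarrow> ((nat \<Rightarrow> 'a) \<Rightarrow> 'b) set monoid" where
  "HS G A act = sym_cohomology G A act (cochains G A)"

definition HSc ::
  "('a, 'm) monoid_scheme \<Rightarrow> 'a topology \<Rightarrow> ('b, 'k) monoid_scheme \<Rightarrow> 'b topology \<Rightarrow>
    ('a \<Rightarrow> 'b \<Rightarrow> 'b) \<Rightarrow> nat \<Rightarrow> ((nat \<Rightarrow> 'a) \<Rightarrow> 'b) set monoid" where
  "HSc G T A TA act = sym_cohomology G A act (cont_cochains G T A TA)"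


section \<open>Direct limits of groups\<close>

text \<open>For a directed set \<open>(I, below)\<close>, groups \<open>H i\<close> and transition maps \<open>f i j : H i \<rightarrow> H j\<close>
  (for \<open>below i j\<close>), the direct limit is the disjoint union of the \<open>H i\<close> modulo eventual equality.
  The product of the classes of \<open>(i, x)\<close> and \<open>(j, y)\<close> is the class of
  \<open>(k, f i k x \<otimes> f j k y)\<close> for any \<open>k\<close> above \<open>i\<close> and \<open>j\<close>; as in \<open>set_mult\<close>, independence of
  the choices is expressed by taking the union over all of them.\<close>

definition dirlim_rel ::
  "'i set \<Rightarrow> ('i \<Rightarrow> 'i \<Rightarrow> bool) \<Rightarrow> ('i \<Rightarrow> ('x, 'm) monoid_scheme) \<Rightarrow> ('i \<Rightarrow> 'i \<Rightarrow> 'x \<Rightarrow> 'x) \<Rightarrow>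
    (('i \<times> 'x) \<times> ('i \<times> 'x)) set" where
  "dirlim_rel I below H f =
    {((i, x), (j, y)) | i x j y. i \<in> I \<and> x \<in> carrier (H i) \<and> j \<in> I \<and> y \<in> carrier (H j) \<and>
       (\<exists>k\<in>I. below i k \<and> below j k \<and> f i k x = f j k y)}"

definition direct_limit ::
  "'i set \<Rightarrow> ('i \<Rightarrow> 'i \<Rightarrow> bool) \<Rightarrow> ('i \<Rightarrow> ('x, 'm) monoid_scheme) \<Rightarrow> ('i \<Rightarrow> 'i \<Rightarrow> 'x \<Rightarrow> 'x) \<Rightarrow>
    ('i \<times> 'x) set monoid" where
  "direct_limit I below H f =
    \<lparr>carrier = (SIGMA i:I. carrier (H i)) // dirlim_rel I below H f,
     monoid.mult = (\<lambda>P Q. \<Union>(i, x)\<in>P. \<Union>(j, y)\<in>Q. \<Union>k\<in>{k \<in> I. below i k \<and> below j k}.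
       dirlim_rel I below H f `` {(k, f i k x \<otimes>\<^bsub>H k\<^esub> f j k y)}),
     one = (\<Union>i\<in>I. dirlim_rel I below H f `` {(i, \<one>\<^bsub>H i\<^esub>)})\<rparr>"


section \<open>The system of finite quotients\<close>

definition open_normal_subgroups :: "('a, 'm) monoid_scheme \<Rightarrow> 'a topology \<Rightarrow> 'a set set" where
  "open_normal_subgroups G T = {U. U \<lhd> G \<and> openin T U}"

definition fixed_points ::
  "('b, 'k) monoid_scheme \<Rightarrow> ('a \<Rightarrow> 'b \<Rightarrow> 'b) \<Rightarrow> 'a set \<Rightarrow> ('b, 'k) monoid_scheme" where
  "fixed_points A act U = A\<lparr>carrier := {a \<in> carrier A. \<forall>u\<in>U. act u a = a}\<rparr>"

text \<open>For a coset \<open>Q = gU\<close> and \<open>a \<in> A\<^sup>U\<close> the set \<open>{ha | h \<in> Q}\<close> has the single element \<open>ga\<close>.\<close>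

definition quotient_act ::
  "('b, 'k) monoid_scheme \<Rightarrow> ('a \<Rightarrow> 'b \<Rightarrow> 'b) \<Rightarrow> 'a set \<Rightarrow> 'a set \<Rightarrow> 'b \<Rightarrow> 'b" where
  "quotient_act A act U Q =
    (\<lambda>a\<in>carrier (fixed_points A act U). the_elem ((\<lambda>h. act h a) ` Q))"

definition quotient_HS ::
  "('a, 'm) monoid_scheme \<Rightarrow> ('b, 'k) monoid_scheme \<Rightarrow> ('a \<Rightarrow> 'b \<Rightarrow> 'b) \<Rightarrow> nat \<Rightarrow> 'a set \<Rightarrow>
    ((nat \<Rightarrow> 'a set) \<Rightarrow> 'b) set monoid" where
  "quotient_HS G A act n U = HS (G Mod U) (fixed_points A act U) (quotient_act A act U) n"

text \<open>The inflation \<open>\<sigma> \<mapsto> \<beta>\<^sub>V\<^sub>U \<circ> \<sigma> \<circ> (\<alpha>\<^sub>U\<^sub>V)\<^sup>n\<close> for \<open>U \<subseteq> V\<close>: the projection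
  \<open>\<alpha>\<^sub>U\<^sub>V : G/U \<rightarrow> G/V\<close> is \<open>Q \<mapsto> VX\<close>, and the inclusion \<open>\<beta>\<^sub>V\<^sub>U\<close> is invisible since both groups of
  fixed points live in the type of \<open>A\<close>.\<close>

definition inflation ::
  "('a, 'm) monoid_scheme \<Rightarrow> nat \<Rightarrow> 'a set \<Rightarrow> 'a set \<Rightarrow>
    ((nat \<Rightarrow> 'a set) \<Rightarrow> 'b) \<Rightarrow> ((nat \<Rightarrow> 'a set) \<Rightarrow> 'b)" where
  "inflation G n V U \<sigma> = (\<lambda>q\<in>tuples (G Mod U) n. \<sigma> (\<lambda>j\<in>{1..n}. V <#>\<^bsub>G\<^esub> q j))"

text \<open>On cohomology, a class \<open>c\<close> (a coset of the coboundaries) goes to the class of the inflation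
  of any of its representatives.\<close>

definition transition ::
  "('a, 'm) monoid_scheme \<Rightarrow> ('b, 'k) monoid_scheme \<Rightarrow> ('a \<Rightarrow> 'b \<Rightarrow> 'b) \<Rightarrow> nat \<Rightarrow>
    'a set \<Rightarrow> 'a set \<Rightarrow> ((nat \<Rightarrow> 'a set) \<Rightarrow> 'b) set \<Rightarrow> ((nat \<Rightarrow> 'a set) \<Rightarrow> 'b) set" where
  "transition G A act n V U c =
    (let H = G Mod U; M = fixed_points A act U; a = quotient_act A act U; C = cochains H M in
     \<Union>\<sigma>\<in>c. sym_coboundaries H M a C n #>\<^bsub>sym_cocycles H M a C n\<^esub> inflation G n V U \<sigma>)"

end

theory Submission
  imports Defs
begin

text \<open>A continuous map \<open>\<sigma> : G\<^sup>n \<rightarrow> A\<close> into a discrete module is locally constant, so by compactness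
  there is an open normal subgroup \<open>U\<close> such that \<open>\<sigma>\<close> is constant on products of cosets of \<open>U\<close> and
  takes values in \<open>A\<^sup>U\<close>. Hence \<open>\<sigma>\<close> is the inflation of a unique cochain of \<open>G/U\<close>. Inflation is
  injective on cochains and commutes with the coboundaries and the symmetric group action, so it
  also reflects symmetry and the cocycle condition, and every relation between classes in
  \<open>HS\<^sub>c\<close> already holds over some \<open>G/U\<close>.\<close>

section \<open>Direct limits of subquotients\<close>

text \<open>The limit is compared with cochains rather than with classes. All cochains of all
  \<open>G/U\<close> embed into one group of cochains of \<open>G\<close>; once the continuous
  cocycles and the continuous coboundaries are each the union of the images from the levels
  \<open>U\<close>, passing to quotients commutes with the directed union. The coboundaries need a
  descent of their own, applied one degree lower. The obstacle is uniformity: local constancy of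
  \<sigma> gives a neighbourhood of each point of \<open>G^n\<close>, whose size depends on the
  point, and the stabiliser of a value depends on the value. Both conditions are therefore written
  as open conditions on pairs of a group element and a tuple, and quantifying over all tuples
  preserves openness because the projection along a compact factor is closed. Phrased through
  translations, the elements so obtained form a subgroup. The same projection argument, with
  \<open>G\<close> itself as the compact factor, makes the normal core of an open subgroup
  open.\<close>

lemma direct_limit_iso:
  fixes L :: "('y, 'l) monoid_scheme" and H :: "'i \<Rightarrow> ('x, 'h) monoid_scheme"
  assumes hom: "\<And>i. i \<in> I \<Longrightarrow> \<phi> i \<in> hom (H i) L"
    and mult_closed: "\<And>i x y. \<lbrakk>i \<in> I; x \<in> carrier (H i); y \<in> carrier (H i)\<rbrakk> \<Longrightarrow>
      x \<otimes>\<^bsub>H i\<^esub> y \<in> carrier (H i)"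
    and f_closed: "\<And>i j x. \<lbrakk>i \<in> I; j \<in> I; below i j; x \<in> carrier (H i)\<rbrakk> \<Longrightarrow> f i j x \<in> carrier (H j)"
    and compat: "\<And>i j x. \<lbrakk>i \<in> I; j \<in> I; below i j; x \<in> carrier (H i)\<rbrakk> \<Longrightarrow> \<phi> j (f i j x) = \<phi> i x"
    and directed: "\<And>i j. \<lbrakk>i \<in> I; j \<in> I\<rbrakk> \<Longrightarrow> \<exists>k\<in>I. below i k \<and> below j k"
    and surj: "\<And>c. c \<in> carrier L \<Longrightarrow> \<exists>i\<in>I. \<exists>x\<in>carrier (H i). \<phi> i x = c"
    and inj: "\<And>i j x y. \<lbrakk>i \<in> I; j \<in> I; x \<in> carrier (H i); y \<in> carrier (H j); \<phi> i x = \<phi> j y\<rbrakk> \<Longrightarrow>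
      \<exists>k\<in>I. below i k \<and> below j k \<and> f i k x = f j k y"
  shows "L \<cong> direct_limit I below H f"
proof -
  \<comment> \<open>The fibre of the maps \<phi> over \<open>c\<close> inside the disjoint union. By
    \<open>inj\<close> and \<open>compat\<close>, \<open>dirlim_rel\<close> is the relation of
    having the same image, so its classes are exactly these fibres and \<Phi> is the isomorphism
    sought.\<close>
  define \<Phi> where "\<Phi> c = {(i, x). i \<in> I \<and> x \<in> carrier (H i) \<and> \<phi> i x = c}" for c
  have rel: "((i, x), (j, y)) \<in> dirlim_rel I below H f \<longleftrightarrow>
      i \<in> I \<and> x \<in> carrier (H i) \<and> j \<in> I \<and> y \<in> carrier (H j) \<and> \<phi> i x = \<phi> j y" for i x j y
    unfolding dirlim_rel_def using inj compat by simp metis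
  have class_eq: "dirlim_rel I below H f `` {(i, x)} = \<Phi> (\<phi> i x)" if "i \<in> I" "x \<in> carrier (H i)" for i x
    using that unfolding \<Phi>_def by (auto simp: rel)
  have carrier_eq: "carrier (direct_limit I below H f) = \<Phi> ` carrier L"
  proof -
    have "(SIGMA i:I. carrier (H i)) // dirlim_rel I below H f =
        (\<lambda>p. dirlim_rel I below H f `` {p}) ` (SIGMA i:I. carrier (H i))"
      by (auto simp: quotient_def)
    also have "\<dots> = (\<lambda>p. \<Phi> (\<phi> (fst p) (snd p))) ` (SIGMA i:I. carrier (H i))"
      using class_eq by (intro image_cong refl) (metis SigmaE fst_conv snd_conv)
    also have "\<dots> = \<Phi> ` (\<lambda>p. \<phi> (fst p) (snd p)) ` (SIGMA i:I. carrier (H i))"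
      by (simp only: image_image)
    also have "(\<lambda>p. \<phi> (fst p) (snd p)) ` (SIGMA i:I. carrier (H i)) = carrier L"
    proof
      show "(\<lambda>p. \<phi> (fst p) (snd p)) ` (SIGMA i:I. carrier (H i)) \<subseteq> carrier L"
        using hom_in_carrier[OF hom] by auto
      show "carrier L \<subseteq> (\<lambda>p. \<phi> (fst p) (snd p)) ` (SIGMA i:I. carrier (H i))"
        using surj by force
    qed
    finally show ?thesis by (simp add: direct_limit_def)
  qed
  have mult: "\<Phi> (c \<otimes>\<^bsub>L\<^esub> d) = \<Phi> c \<otimes>\<^bsub>direct_limit I below H f\<^esub> \<Phi> d"
    if c: "c \<in> carrier L" and d: "d \<in> carrier L" for c d
  proof -
    \<comment> \<open>One member of the union that defines the product in the limit. All members
      equal the same fibre, and the union is inhabited: \<open>surj\<close> provides representatives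
      and \<open>directed\<close> an upper bound.\<close>
    define R where "R i x j y k = dirlim_rel I below H f `` {(k, f i k x \<otimes>\<^bsub>H k\<^esub> f j k y)}" for i x j y k
    have step: "R i x j y k = \<Phi> (c \<otimes>\<^bsub>L\<^esub> d)"
      if "(i, x) \<in> \<Phi> c" "(j, y) \<in> \<Phi> d" "k \<in> I" "below i k" "below j k" for i x j y k
    proof -
      have "f i k x \<in> carrier (H k)" "f j k y \<in> carrier (H k)"
        "\<phi> k (f i k x) = c" "\<phi> k (f j k y) = d"
        using that by (auto simp: \<Phi>_def f_closed compat)
      then show ?thesis
        using \<open>k \<in> I\<close> hom_mult[OF hom[OF \<open>k \<in> I\<close>]] unfolding R_def by (simp only: class_eq mult_closed)
    qed
    obtain i x where ix: "i \<in> I" "(i, x) \<in> \<Phi> c"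
      using surj[OF c] unfolding \<Phi>_def by blast
    obtain j y where jy: "j \<in> I" "(j, y) \<in> \<Phi> d"
      using surj[OF d] unfolding \<Phi>_def by blast
    obtain k where k: "k \<in> I" "below i k" "below j k"
      using directed[OF ix(1) jy(1)] by blast
    have "\<Phi> c \<otimes>\<^bsub>direct_limit I below H f\<^esub> \<Phi> d =
        (\<Union>(i, x)\<in>\<Phi> c. \<Union>(j, y)\<in>\<Phi> d. \<Union>k\<in>{k \<in> I. below i k \<and> below j k}. R i x j y k)"
      by (simp add: direct_limit_def R_def)
    also have "\<dots> = \<Phi> (c \<otimes>\<^bsub>L\<^esub> d)"
    proof
      show "(\<Union>(i, x)\<in>\<Phi> c. \<Union>(j, y)\<in>\<Phi> d. \<Union>k\<in>{k \<in> I. below i k \<and> below j k}. R i x j y k)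
          \<subseteq> \<Phi> (c \<otimes>\<^bsub>L\<^esub> d)"
        using step by blast
      show "\<Phi> (c \<otimes>\<^bsub>L\<^esub> d)
          \<subseteq> (\<Union>(i, x)\<in>\<Phi> c. \<Union>(j, y)\<in>\<Phi> d. \<Union>k\<in>{k \<in> I. below i k \<and> below j k}. R i x j y k)"
        using step[OF ix(2) jy(2) k] ix(2) jy(2) k by blast
    qed
    finally show ?thesis ..
  qed
  have "inj_on \<Phi> (carrier L)"
  proof (rule inj_onI)
    fix c d
    assume c: "c \<in> carrier L" and eq: "\<Phi> c = \<Phi> d"
    obtain i x where "i \<in> I" "x \<in> carrier (H i)" "\<phi> i x = c"
      using surj[OF c] by blast
    then have "(i, x) \<in> \<Phi> d"
      unfolding eq[symmetric] by (simp add: \<Phi>_def)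
    then show "c = d"
      using \<open>\<phi> i x = c\<close> by (simp add: \<Phi>_def)
  qed
  then have "\<Phi> \<in> iso L (direct_limit I below H f)"
    by (simp add: iso_def hom_def bij_betw_def carrier_eq mult)
  then show ?thesis
    unfolding is_iso_def by blast
qed

text \<open>Lets all coset computations in a group of cocycles be carried out in the ambient group
  of cochains.\<close>

lemma r_coset_carrier_update [simp]: "B #>\<^bsub>M\<lparr>carrier := Z\<rparr>\<^esub> x = B #>\<^bsub>M\<^esub> x"
  by (simp add: r_coset_def)

lemma set_mult_carrier_update [simp]: "P <#>\<^bsub>M\<lparr>carrier := Z\<rparr>\<^esub> Q = P <#>\<^bsub>M\<^esub> Q"
  by (simp add: set_mult_def)

text \<open>Evaluates maps on classes that are given, as \<open>transition\<close> is, by a union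
  over all representatives: since \<open>h\<close> sends \<open>B\<close> into \<open>B'\<close>,
  each representative contributes the same coset, and there is at least one.\<close>

lemma UN_cosets_image:
  assumes M: "group M" and N: "group N" and h: "h \<in> hom M N"
    and B: "subgroup B M" and B': "subgroup B' N" and hB: "h ` B \<subseteq> B'" and z: "z \<in> carrier M"
  shows "(\<Union>\<sigma>\<in>B #>\<^bsub>M\<^esub> z. B' #>\<^bsub>N\<^esub> h \<sigma>) = B' #>\<^bsub>N\<^esub> h z"
proof -
  interpret M: group M by fact
  interpret N: group N by fact
  have "B' #>\<^bsub>N\<^esub> h \<sigma> = B' #>\<^bsub>N\<^esub> h z" if "\<sigma> \<in> B #>\<^bsub>M\<^esub> z" for \<sigma>
  proof -
    obtain b where b: "b \<in> B" "\<sigma> = b \<otimes>\<^bsub>M\<^esub> z"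
      using \<open>\<sigma> \<in> B #>\<^bsub>M\<^esub> z\<close> by (auto simp: r_coset_def)
    then have "h \<sigma> = h b \<otimes>\<^bsub>N\<^esub> h z" "h b \<in> B'" "h z \<in> carrier N"
      using h z hB subgroup.mem_carrier[OF B] by (auto simp: hom_def)
    then have "h \<sigma> \<in> B' #>\<^bsub>N\<^esub> h z"
      by (auto simp: r_coset_def)
    then show ?thesis
      using N.repr_independence[OF _ \<open>h z \<in> carrier N\<close> B'] by simp
  qed
  moreover have "B #>\<^bsub>M\<^esub> z \<noteq> {}"
    using M.rcos_self[OF z B] by blast
  ultimately show ?thesis by simp
qed

text \<open>When \<open>B\<close> does not lie in \<open>Z\<close>, \<open>M\<lparr>carrier := Z\<rparr> Mod B\<close> is the subgroup \<open>BZ/B\<close> of \<open>M/B\<close>.\<close>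

lemma subquotient_direct_limit_iso:
  fixes M :: "('y, 'l) monoid_scheme" and Mi :: "'i \<Rightarrow> ('x, 'h) monoid_scheme"
  assumes M: "comm_group M" and Z: "subgroup Z M" and B: "subgroup B M"
    and Mi: "\<And>i. i \<in> I \<Longrightarrow> comm_group (Mi i)"
    and Zi: "\<And>i. i \<in> I \<Longrightarrow> subgroup (Zi i) (Mi i)"
    and Bi: "\<And>i. i \<in> I \<Longrightarrow> subgroup (Bi i) (Mi i)"
    and \<iota>: "\<And>i. i \<in> I \<Longrightarrow> \<iota> i \<in> hom (Mi i) M"
    and \<iota>_inj: "\<And>i. i \<in> I \<Longrightarrow> inj_on (\<iota> i) (carrier (Mi i))"
    and \<iota>_Z: "\<And>i. i \<in> I \<Longrightarrow> \<iota> i ` Zi i \<subseteq> Z"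
    and \<iota>_B: "\<And>i. i \<in> I \<Longrightarrow> \<iota> i ` Bi i \<subseteq> B"
    and f: "\<And>i j. \<lbrakk>i \<in> I; j \<in> I; below i j\<rbrakk> \<Longrightarrow> f i j \<in> hom (Mi i) (Mi j)"
    and f_Z: "\<And>i j. \<lbrakk>i \<in> I; j \<in> I; below i j\<rbrakk> \<Longrightarrow> f i j ` Zi i \<subseteq> Zi j"
    and f_B: "\<And>i j. \<lbrakk>i \<in> I; j \<in> I; below i j\<rbrakk> \<Longrightarrow> f i j ` Bi i \<subseteq> Bi j"
    and \<iota>_f: "\<And>i j x. \<lbrakk>i \<in> I; j \<in> I; below i j; x \<in> carrier (Mi i)\<rbrakk> \<Longrightarrow> \<iota> j (f i j x) = \<iota> i x"
    and directed: "\<And>i j. \<lbrakk>i \<in> I; j \<in> I\<rbrakk> \<Longrightarrow> \<exists>k\<in>I. below i k \<and> below j k"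
    and below_trans: "\<And>i j k. \<lbrakk>below i j; below j k\<rbrakk> \<Longrightarrow> below i k"
    and surj_Z: "\<And>z. z \<in> Z \<Longrightarrow> \<exists>i\<in>I. z \<in> \<iota> i ` Zi i"
    and surj_B: "\<And>b. b \<in> B \<Longrightarrow> \<exists>i\<in>I. b \<in> \<iota> i ` Bi i"
  shows "M\<lparr>carrier := Z\<rparr> Mod B \<cong>
    direct_limit I below (\<lambda>i. Mi i\<lparr>carrier := Zi i\<rparr> Mod Bi i)
      (\<lambda>i j c. \<Union>\<sigma>\<in>c. Bi j #>\<^bsub>Mi j\<lparr>carrier := Zi j\<rparr>\<^esub> f i j \<sigma>)"
proof -
  interpret M: comm_group M by fact
  have Z_sub: "z \<in> carrier M" if "z \<in> Z" for z
    using that Z by (rule subgroup.mem_carrier[rotated])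
  have Zi_sub: "z \<in> carrier (Mi i)" if "i \<in> I" "z \<in> Zi i" for i z
    using that Zi by (meson subgroup.mem_carrier)
  have Bi_sub: "z \<in> carrier (Mi i)" if "i \<in> I" "z \<in> Bi i" for i z
    using that Bi by (meson subgroup.mem_carrier)
  have Gi: "group (Mi i)" if "i \<in> I" for i
    using Mi[OF that] by (rule comm_group.axioms)
  have coset_mult: "(C #>\<^bsub>N\<^esub> x) <#>\<^bsub>N\<^esub> (C #>\<^bsub>N\<^esub> y) = C #>\<^bsub>N\<^esub> (x \<otimes>\<^bsub>N\<^esub> y)"
    if "comm_group N" "subgroup C N" "x \<in> carrier N" "y \<in> carrier N"
    for N :: "('w, 'v) monoid_scheme" and C x y
    using that by (simp add: comm_group.normal_iff_subgroup normal.rcos_sum)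
  \<comment> \<open>Written as a union over representatives like the transition maps, so that
    \<open>UN_cosets_image\<close> computes both.\<close>
  define \<phi> where "\<phi> i c = (\<Union>\<sigma>\<in>c. B #>\<^bsub>M\<^esub> \<iota> i \<sigma>)" for i c
  have \<phi>_coset: "\<phi> i (Bi i #>\<^bsub>Mi i\<^esub> z) = B #>\<^bsub>M\<^esub> \<iota> i z" if "i \<in> I" "z \<in> carrier (Mi i)" for i z
    unfolding \<phi>_def using that \<iota> \<iota>_B Bi B Gi by (intro UN_cosets_image) auto
  have f_coset: "(\<Union>\<sigma>\<in>Bi i #>\<^bsub>Mi i\<^esub> z. Bi j #>\<^bsub>Mi j\<^esub> f i j \<sigma>) = Bi j #>\<^bsub>Mi j\<^esub> f i j z"
    if "i \<in> I" "j \<in> I" "below i j" "z \<in> carrier (Mi i)" for i j z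
    using that f f_B Bi Gi by (intro UN_cosets_image) auto
  show ?thesis
  proof (rule direct_limit_iso[where \<phi> = \<phi>])
    fix i assume i: "i \<in> I"
    show "\<phi> i \<in> hom (Mi i\<lparr>carrier := Zi i\<rparr> Mod Bi i) (M\<lparr>carrier := Z\<rparr> Mod B)"
    proof (rule homI)
      fix c assume "c \<in> carrier (Mi i\<lparr>carrier := Zi i\<rparr> Mod Bi i)"
      then show "\<phi> i c \<in> carrier (M\<lparr>carrier := Z\<rparr> Mod B)"
        using i \<iota>_Z[OF i] by (auto simp: carrier_FactGroup \<phi>_coset Zi_sub intro!: imageI)
    next
      fix c d
      assume "c \<in> carrier (Mi i\<lparr>carrier := Zi i\<rparr> Mod Bi i)" "d \<in> carrier (Mi i\<lparr>carrier := Zi i\<rparr> Mod Bi i)"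
      then obtain z w where zw: "z \<in> Zi i" "w \<in> Zi i" "c = Bi i #>\<^bsub>Mi i\<^esub> z" "d = Bi i #>\<^bsub>Mi i\<^esub> w"
        by (auto simp: carrier_FactGroup)
      moreover have "\<iota> i (z \<otimes>\<^bsub>Mi i\<^esub> w) = \<iota> i z \<otimes>\<^bsub>M\<^esub> \<iota> i w" "\<iota> i z \<in> carrier M" "\<iota> i w \<in> carrier M"
        using zw i \<iota>[OF i] Zi_sub by (auto simp: hom_def)
      moreover have "z \<otimes>\<^bsub>Mi i\<^esub> w \<in> carrier (Mi i)"
        using zw i Zi_sub Zi subgroup.m_closed by meson
      ultimately show "\<phi> i (c \<otimes>\<^bsub>Mi i\<lparr>carrier := Zi i\<rparr> Mod Bi i\<^esub> d) =
          \<phi> i c \<otimes>\<^bsub>M\<lparr>carrier := Z\<rparr> Mod B\<^esub> \<phi> i d"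
        using i M B Mi[OF i] Bi[OF i] by (simp add: coset_mult \<phi>_coset Zi_sub)
    qed
  next
    fix i c d
    assume i: "i \<in> I" and "c \<in> carrier (Mi i\<lparr>carrier := Zi i\<rparr> Mod Bi i)"
      "d \<in> carrier (Mi i\<lparr>carrier := Zi i\<rparr> Mod Bi i)"
    then obtain z w where "z \<in> Zi i" "w \<in> Zi i" "c = Bi i #>\<^bsub>Mi i\<^esub> z" "d = Bi i #>\<^bsub>Mi i\<^esub> w"
      by (auto simp: carrier_FactGroup)
    then show "c \<otimes>\<^bsub>Mi i\<lparr>carrier := Zi i\<rparr> Mod Bi i\<^esub> d \<in> carrier (Mi i\<lparr>carrier := Zi i\<rparr> Mod Bi i)"
      using i Mi[OF i] Bi[OF i] subgroup.m_closed[OF Zi[OF i]]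
      by (auto simp: coset_mult Zi_sub carrier_FactGroup)
  next
    fix i j c
    assume ij: "i \<in> I" "j \<in> I" "below i j" and "c \<in> carrier (Mi i\<lparr>carrier := Zi i\<rparr> Mod Bi i)"
    then obtain z where z: "z \<in> Zi i" "c = Bi i #>\<^bsub>Mi i\<^esub> z"
      by (auto simp: carrier_FactGroup)
    then have fz: "f i j z \<in> Zi j"
      using f_Z ij by blast
    have eq: "(\<Union>\<sigma>\<in>c. Bi j #>\<^bsub>Mi j\<lparr>carrier := Zi j\<rparr>\<^esub> f i j \<sigma>) = Bi j #>\<^bsub>Mi j\<^esub> f i j z"
      using ij z by (simp add: f_coset Zi_sub)
    show "(\<Union>\<sigma>\<in>c. Bi j #>\<^bsub>Mi j\<lparr>carrier := Zi j\<rparr>\<^esub> f i j \<sigma>) \<in> carrier (Mi j\<lparr>carrier := Zi j\<rparr> Mod Bi j)"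
      unfolding eq using fz by (auto simp: carrier_FactGroup)
    show "\<phi> j (\<Union>\<sigma>\<in>c. Bi j #>\<^bsub>Mi j\<lparr>carrier := Zi j\<rparr>\<^esub> f i j \<sigma>) = \<phi> i c"
      unfolding eq using ij z fz by (simp add: \<phi>_coset Zi_sub \<iota>_f)
  next
    fix c assume "c \<in> carrier (M\<lparr>carrier := Z\<rparr> Mod B)"
    then obtain z where "z \<in> Z" "c = B #>\<^bsub>M\<^esub> z"
      by (auto simp: carrier_FactGroup)
    moreover from surj_Z[OF \<open>z \<in> Z\<close>] obtain i x where "i \<in> I" "x \<in> Zi i" "z = \<iota> i x"
      by blast
    ultimately show "\<exists>i\<in>I. \<exists>x\<in>carrier (Mi i\<lparr>carrier := Zi i\<rparr> Mod Bi i). \<phi> i x = c"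
      by (intro bexI[of _ i] bexI[of _ "Bi i #>\<^bsub>Mi i\<^esub> x"])
        (auto simp: carrier_FactGroup \<phi>_coset Zi_sub)
  next
    fix i j c d
    assume ij: "i \<in> I" "j \<in> I" and "c \<in> carrier (Mi i\<lparr>carrier := Zi i\<rparr> Mod Bi i)"
      "d \<in> carrier (Mi j\<lparr>carrier := Zi j\<rparr> Mod Bi j)" and eq: "\<phi> i c = \<phi> j d"
    then obtain z w where zw: "z \<in> Zi i" "w \<in> Zi j" "c = Bi i #>\<^bsub>Mi i\<^esub> z" "d = Bi j #>\<^bsub>Mi j\<^esub> w"
      by (auto simp: carrier_FactGroup)
    have \<iota>_zw: "\<iota> i z \<in> Z" "\<iota> j w \<in> Z"
      using zw ij \<iota>_Z by auto
    have "B #>\<^bsub>M\<^esub> \<iota> i z = B #>\<^bsub>M\<^esub> \<iota> j w"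
      using eq zw ij by (simp add: \<phi>_coset Zi_sub)
    then have "\<iota> i z \<in> B #>\<^bsub>M\<^esub> \<iota> j w"
      using M.rcos_self[OF Z_sub[OF \<iota>_zw(1)] B] by simp
    then obtain b where b: "b \<in> B" "\<iota> i z = b \<otimes>\<^bsub>M\<^esub> \<iota> j w"
      by (auto simp: r_coset_def)
    \<comment> \<open>The element \<open>b\<close> relating the two classes comes from a level
      \<open>l\<close> unrelated to \<open>i\<close> and \<open>j\<close>, so the level
      \<open>k\<close> at which the relation is to hold must lie above all three.\<close>
    from surj_B[OF b(1)] obtain l x where l: "l \<in> I" "x \<in> Bi l" "b = \<iota> l x"
      by blast
    from directed[OF ij] obtain k' where k': "k' \<in> I" "below i k'" "below j k'"
      by blast
    from directed[OF k'(1) l(1)] obtain k where "k \<in> I" "below k' k" "below l k"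
      by blast
    with k' have k: "k \<in> I" "below i k" "below j k" "below l k"
      using below_trans by blast+
    interpret k: comm_group "Mi k" using Mi[OF k(1)] .
    have fc: "f i k z \<in> carrier (Mi k)" "f j k w \<in> carrier (Mi k)" "f l k x \<in> Bi k"
      using f_Z f_B ij l(1,2) k zw Zi_sub by blast+
    \<comment> \<open>The relation is transported to level \<open>k\<close> on elements, where
      \<open>\<iota> k\<close> is injective, before any passage to cosets.\<close>
    have "\<iota> k (f i k z) = \<iota> k (f l k x \<otimes>\<^bsub>Mi k\<^esub> f j k w)"
      using fc b l ij k zw hom_mult[OF \<iota>[OF k(1)]] by (simp add: \<iota>_f Zi_sub Bi_sub)
    then have "f i k z = f l k x \<otimes>\<^bsub>Mi k\<^esub> f j k w"
      using inj_onD[OF \<iota>_inj[OF k(1)]] fc Bi_sub[OF k(1)] k.m_closed by blast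
    then have "f i k z \<in> Bi k #>\<^bsub>Mi k\<^esub> f j k w"
      using fc by (auto simp: r_coset_def)
    then have "Bi k #>\<^bsub>Mi k\<^esub> f i k z = Bi k #>\<^bsub>Mi k\<^esub> f j k w"
      using k.repr_independence[OF _ fc(2) Bi[OF k(1)]] by simp
    then show "\<exists>k\<in>I. below i k \<and> below j k \<and>
        (\<Union>\<sigma>\<in>c. Bi k #>\<^bsub>Mi k\<lparr>carrier := Zi k\<rparr>\<^esub> f i k \<sigma>) =
        (\<Union>\<sigma>\<in>d. Bi k #>\<^bsub>Mi k\<lparr>carrier := Zi k\<rparr>\<^esub> f j k \<sigma>)"
      using k zw ij by (intro bexI[of _ k]) (simp_all add: f_coset Zi_sub)
  qed (rule directed)
qed

section \<open>Groups of cochains\<close>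

text \<open>The ambient group, with the operations of \<open>sym_cochains\<close>. Cocycles,
  coboundaries and continuous cochains all become subgroups of it, which is the setting of
  \<open>subquotient_direct_limit_iso\<close>.\<close>

definition cochain_group ::
  "('a, 'm) monoid_scheme \<Rightarrow> ('b, 'k) monoid_scheme \<Rightarrow> nat \<Rightarrow> ((nat \<Rightarrow> 'a) \<Rightarrow> 'b) monoid" where
  "cochain_group G A n =
    \<lparr>carrier = cochains G A n,
     monoid.mult = (\<lambda>\<sigma> \<tau>. \<lambda>g\<in>tuples G n. \<sigma> g \<otimes>\<^bsub>A\<^esub> \<tau> g),
     one = (\<lambda>g\<in>tuples G n. \<one>\<^bsub>A\<^esub>)\<rparr>"

lemma tuplesI: "\<lbrakk>\<And>j. j \<in> {1..n} \<Longrightarrow> g j \<in> carrier G; g \<in> extensional {1..n}\<rbrakk> \<Longrightarrow> g \<in> tuples G n"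
  by (simp add: tuples_def PiE_def)

lemma tuples_mem: "\<lbrakk>g \<in> tuples G n; j \<in> {1..n}\<rbrakk> \<Longrightarrow> g j \<in> carrier G"
  by (auto simp: tuples_def)

lemma cochain_mem: "\<lbrakk>\<sigma> \<in> cochains G A n; g \<in> tuples G n\<rbrakk> \<Longrightarrow> \<sigma> g \<in> carrier A"
  by (auto simp: cochains_def)

lemma cochain_eqI:
  "\<lbrakk>\<sigma> \<in> cochains G A n; \<tau> \<in> cochains G A n; \<And>g. g \<in> tuples G n \<Longrightarrow> \<sigma> g = \<tau> g\<rbrakk> \<Longrightarrow> \<sigma> = \<tau>"
  unfolding cochains_def by (rule extensionalityI[of _ "tuples G n"]) (auto simp: PiE_def)

lemma restrict_cochain: "(\<And>g. g \<in> tuples G n \<Longrightarrow> f g \<in> carrier A) \<Longrightarrow> (\<lambda>g\<in>tuples G n. f g) \<in> cochains G A n"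
  by (simp add: cochains_def)

lemma comm_group_cochain_group:
  assumes "comm_group A"
  shows "comm_group (cochain_group G A n)"
proof -
  interpret A: comm_group A by fact
  have inv: "\<exists>\<tau>\<in>cochains G A n. (\<lambda>g\<in>tuples G n. \<tau> g \<otimes>\<^bsub>A\<^esub> \<sigma> g) = (\<lambda>g\<in>tuples G n. \<one>\<^bsub>A\<^esub>)"
    if "\<sigma> \<in> cochains G A n" for \<sigma>
    by (rule bexI[of _ "\<lambda>g\<in>tuples G n. inv\<^bsub>A\<^esub> \<sigma> g"])
      (use that in \<open>auto intro!: restrict_cochain restrict_ext simp: cochain_mem\<close>)
  show ?thesis
    by (rule comm_groupI)
      (auto simp: cochain_group_def cochain_mem A.m_ac inv intro!: restrict_cochain restrict_ext
        intro: cochain_eqI[of _ G A n] restrict_cochain)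
qed

lemma inv_cochain_group:
  assumes "comm_group A" "\<sigma> \<in> cochains G A n"
  shows "inv\<^bsub>cochain_group G A n\<^esub> \<sigma> = (\<lambda>g\<in>tuples G n. inv\<^bsub>A\<^esub> \<sigma> g)"
proof -
  interpret A: comm_group A by fact
  interpret C: comm_group "cochain_group G A n"
    by (rule comm_group_cochain_group) fact
  show ?thesis
    by (rule C.inv_equality)
      (use assms(2) in \<open>auto simp: cochain_group_def cochain_mem intro!: restrict_cochain restrict_ext\<close>)
qed

text \<open>By \<open>sym_invariant_iff\<close> invariance need only be tested on the generators, so
  words in transpositions do not appear from here on.\<close>

lemma carrier_sym_cochains:
  "carrier (sym_cochains G A act C n) = {\<sigma> \<in> C n. \<forall>i\<in>{1..n}. adj_act G A act n i \<sigma> = \<sigma>}"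
  unfolding sym_cochains_def by (simp only: sym_invariant_iff partial_object.simps)

lemma sym_cocycles_eq:
  "sym_cocycles G A act C n = cochain_group G A n\<lparr>carrier := carrier (sym_cocycles G A act C n)\<rparr>"
  by (simp add: sym_cocycles_def sym_cochains_def cochain_group_def)

text \<open>A kernel compares values with the neutral element only, and symmetric cochains share
  theirs with all cochains; the target of the coboundary may thus be enlarged to
  \<open>cochain_group\<close>.\<close>

lemma carrier_sym_cocycles:
  "carrier (sym_cocycles G A act C n) =
    {\<sigma> \<in> carrier (sym_cochains G A act C n). coboundary G A act n \<sigma> = \<one>\<^bsub>cochain_group G A (n + 1)\<^esub>}"
  by (auto simp: sym_cocycles_def kernel_def sym_cochains_def cochain_group_def)

text \<open>The algebraic data common to \<open>G\<close>, with topologies forgotten, and to every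
  \<open>G Mod U\<close>. Asking for endomorphisms is enough: \<open>act_one\<close> and
  \<open>act_mult\<close> make them invertible on the carrier.\<close>

locale G_module = G: group G + A: comm_group A
  for G :: "('a, 'm) monoid_scheme" and A :: "('b, 'k) monoid_scheme" +
  fixes act :: "'a \<Rightarrow> 'b \<Rightarrow> 'b"
  assumes act_hom: "g \<in> carrier G \<Longrightarrow> act g \<in> hom A A"
    and act_one: "a \<in> carrier A \<Longrightarrow> act \<one>\<^bsub>G\<^esub> a = a"
    and act_mult: "\<lbrakk>g \<in> carrier G; h \<in> carrier G; a \<in> carrier A\<rbrakk> \<Longrightarrow> act (g \<otimes>\<^bsub>G\<^esub> h) a = act g (act h a)"
begin

lemma act_closed: "\<lbrakk>g \<in> carrier G; a \<in> carrier A\<rbrakk> \<Longrightarrow> act g a \<in> carrier A"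
  using act_hom by (rule hom_in_carrier)

lemma face_tuple: "\<lbrakk>g \<in> tuples G (n + 1)\<rbrakk> \<Longrightarrow> face G n i g \<in> tuples G n"
  by (rule tuplesI) (auto simp: face_def intro!: tuples_mem G.m_closed)

lemma adj_args_tuple: "\<lbrakk>g \<in> tuples G n; i \<in> {1..n}\<rbrakk> \<Longrightarrow> adj_args G n i g \<in> tuples G n"
  by (rule tuplesI) (auto simp: adj_args_def intro!: tuples_mem G.m_closed G.inv_closed)

lemma coboundary_closed: "\<sigma> \<in> cochains G A n \<Longrightarrow> coboundary G A act n \<sigma> \<in> cochains G A (n + 1)"
  unfolding coboundary_def
  by (rule restrict_cochain) (auto intro!: A.m_closed A.finprod_closed A.int_pow_closed act_closed
    tuples_mem[of _ G "Suc n"] cochain_mem[of \<sigma> G A n] face_tuple[simplified])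

lemma adj_act_closed:
  "\<lbrakk>\<sigma> \<in> cochains G A n; i \<in> {1..n}\<rbrakk> \<Longrightarrow> adj_act G A act n i \<sigma> \<in> cochains G A n"
  unfolding adj_act_def
  by (rule restrict_cochain)
    (auto intro!: A.inv_closed act_closed tuples_mem[of _ G n] cochain_mem[of \<sigma> G A n] adj_args_tuple)

lemma cochain_mult:
  "\<lbrakk>\<sigma> \<in> cochains G A n; \<tau> \<in> cochains G A n\<rbrakk> \<Longrightarrow> (\<lambda>g\<in>tuples G n. \<sigma> g \<otimes>\<^bsub>A\<^esub> \<tau> g) \<in> cochains G A n"
  by (rule restrict_cochain) (simp add: cochain_mem)

lemma coboundary_hom: "coboundary G A act n \<in> hom (cochain_group G A n) (cochain_group G A (n + 1))"
proof (rule homI)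
  fix \<sigma> \<tau>
  assume "\<sigma> \<in> carrier (cochain_group G A n)" "\<tau> \<in> carrier (cochain_group G A n)"
  then have \<sigma>: "\<sigma> \<in> cochains G A n" and \<tau>: "\<tau> \<in> cochains G A n"
    by (simp_all add: cochain_group_def)
  have "coboundary G A act n (\<lambda>g\<in>tuples G n. \<sigma> g \<otimes>\<^bsub>A\<^esub> \<tau> g) g =
      coboundary G A act n \<sigma> g \<otimes>\<^bsub>A\<^esub> coboundary G A act n \<tau> g" if g: "g \<in> tuples G (n + 1)" for g
  proof -
    have g1: "g 1 \<in> carrier G"
      using g by (rule tuples_mem) simp
    have [simp]: "face G n i g \<in> tuples G n" "\<sigma> (face G n i g) \<in> carrier A"
      "\<tau> (face G n i g) \<in> carrier A" for i
      using face_tuple[OF g] \<sigma> \<tau> by (simp_all add: cochain_mem)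
    have [simp]: "act (g 1) (\<sigma> (face G n 0 g)) \<in> carrier A" "act (g 1) (\<tau> (face G n 0 g)) \<in> carrier A"
      using g1 by (simp_all add: act_closed)
    have [simp]: "finprod A (\<lambda>i. \<sigma> (face G n i g) [^]\<^bsub>A\<^esub> ((- 1) ^ i :: int)) {1..n} \<in> carrier A"
      "finprod A (\<lambda>i. \<tau> (face G n i g) [^]\<^bsub>A\<^esub> ((- 1) ^ i :: int)) {1..n} \<in> carrier A"
      by (simp_all add: A.finprod_closed)
    have "finprod A (\<lambda>i. (\<sigma> (face G n i g) \<otimes>\<^bsub>A\<^esub> \<tau> (face G n i g)) [^]\<^bsub>A\<^esub> ((- 1) ^ i :: int)) {1..n} =
        finprod A (\<lambda>i. \<sigma> (face G n i g) [^]\<^bsub>A\<^esub> ((- 1) ^ i :: int)) {1..n} \<otimes>\<^bsub>A\<^esub>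
        finprod A (\<lambda>i. \<tau> (face G n i g) [^]\<^bsub>A\<^esub> ((- 1) ^ i :: int)) {1..n}"
      by (simp add: A.int_pow_distrib A.finprod_multf)
    with g show ?thesis
      by (simp add: coboundary_def A.int_pow_distrib hom_mult[OF act_hom[OF g1]] A.m_ac del: One_nat_def)
  qed
  then show "coboundary G A act n (\<sigma> \<otimes>\<^bsub>cochain_group G A n\<^esub> \<tau>) =
      coboundary G A act n \<sigma> \<otimes>\<^bsub>cochain_group G A (n + 1)\<^esub> coboundary G A act n \<tau>"
    using \<sigma> \<tau>
    by (intro cochain_eqI[of _ G A "n + 1"])
      (simp_all add: cochain_group_def coboundary_closed[simplified] cochain_mult)
qed (simp add: cochain_group_def coboundary_closed[simplified])

lemma adj_act_hom:
  assumes i: "i \<in> {1..n}"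
  shows "adj_act G A act n i \<in> hom (cochain_group G A n) (cochain_group G A n)"
proof (rule homI)
  fix \<sigma> \<tau>
  assume "\<sigma> \<in> carrier (cochain_group G A n)" "\<tau> \<in> carrier (cochain_group G A n)"
  then have \<sigma>: "\<sigma> \<in> cochains G A n" and \<tau>: "\<tau> \<in> cochains G A n"
    by (simp_all add: cochain_group_def)
  have "adj_act G A act n i (\<lambda>g\<in>tuples G n. \<sigma> g \<otimes>\<^bsub>A\<^esub> \<tau> g) g =
      adj_act G A act n i \<sigma> g \<otimes>\<^bsub>A\<^esub> adj_act G A act n i \<tau> g" if g: "g \<in> tuples G n" for g
  proof -
    have g1: "g 1 \<in> carrier G"
      using g i by (intro tuples_mem) auto
    have "adj_args G n i g \<in> tuples G n" "\<sigma> (adj_args G n i g) \<in> carrier A"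
      "\<tau> (adj_args G n i g) \<in> carrier A"
      using adj_args_tuple[OF g i] \<sigma> \<tau> by (simp_all add: cochain_mem)
    with g g1 show ?thesis
      by (cases "i = 1") (simp_all add: adj_act_def hom_mult[OF act_hom[OF g1]] A.inv_mult act_closed del: One_nat_def)
  qed
  then show "adj_act G A act n i (\<sigma> \<otimes>\<^bsub>cochain_group G A n\<^esub> \<tau>) =
      adj_act G A act n i \<sigma> \<otimes>\<^bsub>cochain_group G A n\<^esub> adj_act G A act n i \<tau>"
    using \<sigma> \<tau> i
    by (intro cochain_eqI[of _ G A n])
      (simp_all add: cochain_group_def adj_act_closed cochain_mult)
qed (use i in \<open>simp add: cochain_group_def adj_act_closed\<close>)

text \<open>Each condition \<open>adj_act G A act n i \<sigma> = \<sigma>\<close> is the equality of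
  two homomorphisms at \<sigma>. The family \<open>C\<close> stays a parameter so that one proof
  covers all cochains and the continuous ones.\<close>

lemma subgroup_sym_cochains:
  assumes C: "subgroup (C n) (cochain_group G A n)"
  shows "subgroup (carrier (sym_cochains G A act C n)) (cochain_group G A n)"
proof -
  interpret M: comm_group "cochain_group G A n"
    by (rule comm_group_cochain_group) unfold_locales
  have hom: "group_hom (cochain_group G A n) (cochain_group G A n) (adj_act G A act n i)"
    if "i \<in> {1..n}" for i
    using adj_act_hom[OF that] by unfold_locales
  show ?thesis
    unfolding carrier_sym_cochains
  proof (rule M.subgroupI)
    show "{\<sigma> \<in> C n. \<forall>i\<in>{1..n}. adj_act G A act n i \<sigma> = \<sigma>} \<noteq> {}"
      using subgroup.one_closed[OF C] group_hom.hom_one[OF hom] by blast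
  qed (use subgroup.subset[OF C] subgroup.m_inv_closed[OF C] subgroup.m_closed[OF C]
      in \<open>auto simp: subsetD group_hom.hom_inv[OF hom] hom_mult[OF adj_act_hom]\<close>)
qed

lemma subgroup_sym_cocycles:
  assumes C: "subgroup (C n) (cochain_group G A n)"
  shows "subgroup (carrier (sym_cocycles G A act C n)) (cochain_group G A n)"
proof -
  interpret M: comm_group "cochain_group G A n"
    by (rule comm_group_cochain_group) unfold_locales
  interpret M': comm_group "cochain_group G A (n + 1)"
    by (rule comm_group_cochain_group) unfold_locales
  interpret d: group_hom "cochain_group G A n" "cochain_group G A (n + 1)" "coboundary G A act n"
    using coboundary_hom by unfold_locales
  have S: "subgroup (carrier (sym_cochains G A act C n)) (cochain_group G A n)"
    using C by (rule subgroup_sym_cochains)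
  have "carrier (sym_cocycles G A act C n) = carrier (sym_cochains G A act C n) \<inter>
      kernel (cochain_group G A n) (cochain_group G A (n + 1)) (coboundary G A act n)"
    using subgroup.subset[OF S] by (auto simp: carrier_sym_cocycles kernel_def)
  then show ?thesis
    using M.subgroups_Inter_pair[OF S d.subgroup_kernel] by simp
qed

text \<open>Coboundaries of degree \<open>Suc m\<close> are the image of a subgroup of degree
  \<open>m\<close>, hence the hypothesis in every degree. In degree \<open>0\<close> there is no
  lower degree and the group is trivial by definition.\<close>

lemma subgroup_sym_coboundaries:
  assumes C: "\<And>n. subgroup (C n) (cochain_group G A n)"
  shows "subgroup (sym_coboundaries G A act C n) (cochain_group G A n)"
proof (cases n)
  case 0
  interpret M: comm_group "cochain_group G A 0"
    by (rule comm_group_cochain_group) unfold_locales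
  have "sym_coboundaries G A act C 0 = {\<one>\<^bsub>cochain_group G A 0\<^esub>}"
    by (simp add: sym_coboundaries_def sym_cochains_def cochain_group_def)
  then show ?thesis
    using 0 M.triv_subgroup by simp
next
  case (Suc m)
  interpret M: comm_group "cochain_group G A m"
    by (rule comm_group_cochain_group) unfold_locales
  interpret M': comm_group "cochain_group G A (m + 1)"
    by (rule comm_group_cochain_group) unfold_locales
  interpret d: group_hom "cochain_group G A m" "cochain_group G A (m + 1)" "coboundary G A act m"
    using coboundary_hom by unfold_locales
  show ?thesis
    using d.subgroup_img_is_subgroup[OF subgroup_sym_cochains[of C, OF C]] Suc
    by (simp add: sym_coboundaries_def)
qed

end

section \<open>Change of groups\<close>

text \<open>Common form of the inflation from \<open>G/U\<close> to \<open>G\<close> and of the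
  transition from \<open>G/V\<close> to \<open>G/U\<close>.\<close>

definition pullback ::
  "('a, 'm) monoid_scheme \<Rightarrow> nat \<Rightarrow> ('a \<Rightarrow> 'c) \<Rightarrow> ((nat \<Rightarrow> 'c) \<Rightarrow> 'b) \<Rightarrow> ((nat \<Rightarrow> 'a) \<Rightarrow> 'b)" where
  "pullback G n p \<sigma> = (\<lambda>g\<in>tuples G n. \<sigma> (\<lambda>j\<in>{1..n}. p (g j)))"

lemma (in comm_group) comm_group_subgroup:
  assumes S: "subgroup S G"
  shows "comm_group (G\<lparr>carrier := S\<rparr>)"
  using subgroup.subgroup_is_group[OF S is_group] subgroup.mem_carrier[OF S]
  by (intro group.group_comm_groupI) (auto simp: m_comm)

text \<open>The coboundary with values in \<open>A\<^sup>U\<close> forms its product in a different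
  structure from the one with values in \<open>A\<close>. The two agree because all partial products
  stay in the subgroup.\<close>

lemma (in comm_group) finprod_subgroup:
  assumes S: "subgroup S G" and "finite I" "f \<in> I \<rightarrow> S"
  shows "finprod (G\<lparr>carrier := S\<rparr>) f I = finprod G f I"
proof -
  interpret S: comm_group "G\<lparr>carrier := S\<rparr>"
    using S by (rule comm_group_subgroup)
  show ?thesis
    using assms(2,3)
  proof (induction I rule: finite_induct)
    case (insert i I)
    have "f \<in> I \<rightarrow> carrier G" "f i \<in> carrier G"
      using insert.prems subgroup.mem_carrier[OF S] by auto
    then show ?case
      using insert by (simp add: Pi_iff)
  qed simp
qed

text \<open>A compatible pair: a homomorphism \<open>p\<close> of groups and an inclusion of modules
  in the opposite direction. \<open>B_eq\<close> is an equation of structures, so that inverses,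
  powers and products in \<open>B\<close> can be rewritten into those of \<open>A\<close>.\<close>

locale module_pullback = G: G_module G A act + H: G_module H B actB
  for G :: "('a, 'm) monoid_scheme" and A :: "('b, 'k) monoid_scheme" and act
    and H :: "('c, 'n) monoid_scheme" and B :: "('b, 'k) monoid_scheme" and actB +
  fixes p :: "'a \<Rightarrow> 'c"
  assumes B_eq: "B = A\<lparr>carrier := carrier B\<rparr>"
    and B_subgroup: "subgroup (carrier B) A"
    and p_hom: "p \<in> hom G H"
    and act_compat: "\<lbrakk>g \<in> carrier G; b \<in> carrier B\<rbrakk> \<Longrightarrow> act g b = actB (p g) b"
begin

lemma B_mem: "b \<in> carrier B \<Longrightarrow> b \<in> carrier A"
  using B_subgroup by (rule subgroup.mem_carrier)

lemma B_mult: "a \<otimes>\<^bsub>B\<^esub> b = a \<otimes>\<^bsub>A\<^esub> b"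
  by (subst B_eq) simp

lemma B_one: "\<one>\<^bsub>B\<^esub> = \<one>\<^bsub>A\<^esub>"
  by (subst B_eq) simp

lemma B_inv: "b \<in> carrier B \<Longrightarrow> inv\<^bsub>B\<^esub> b = inv\<^bsub>A\<^esub> b"
  by (subst B_eq) (rule G.A.m_inv_consistent[OF B_subgroup])

lemma B_int_pow: "b \<in> carrier B \<Longrightarrow> b [^]\<^bsub>B\<^esub> (k :: int) = b [^]\<^bsub>A\<^esub> k"
  by (subst B_eq) (rule G.A.int_pow_consistent[OF B_subgroup, symmetric])

lemma B_finprod: "\<lbrakk>finite I; f \<in> I \<rightarrow> carrier B\<rbrakk> \<Longrightarrow> finprod B f I = finprod A f I"
  by (subst B_eq) (rule G.A.finprod_subgroup[OF B_subgroup])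

sublocale p: group_hom G H p
  using p_hom by unfold_locales

lemma map_tuple: "g \<in> tuples G n \<Longrightarrow> (\<lambda>j\<in>{1..n}. p (g j)) \<in> tuples H n"
  by (intro tuplesI) (auto intro!: p.hom_closed tuples_mem)

lemma pullback_closed: "\<sigma> \<in> cochains H B n \<Longrightarrow> pullback G n p \<sigma> \<in> cochains G A n"
  unfolding pullback_def by (intro restrict_cochain B_mem) (rule cochain_mem, assumption, rule map_tuple)

lemma pullback_hom: "pullback G n p \<in> hom (cochain_group H B n) (cochain_group G A n)"
  by (rule homI)
    (auto simp: cochain_group_def pullback_closed, auto simp: pullback_def map_tuple B_mult
      simp del: One_nat_def intro!: restrict_ext)

lemma face_map:
  assumes "g \<in> tuples G (n + 1)"
  shows "face H n i (\<lambda>j\<in>{1..n + 1}. p (g j)) = (\<lambda>j\<in>{1..n}. p (face G n i g j))"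
  unfolding face_def using assms by (intro restrict_ext) (auto simp: tuples_mem)

lemma adj_args_map:
  assumes "g \<in> tuples G n" "i \<in> {1..n}"
  shows "adj_args H n i (\<lambda>j\<in>{1..n}. p (g j)) = (\<lambda>j\<in>{1..n}. p (adj_args G n i g j))"
  unfolding adj_args_def using assms by (intro restrict_ext) (auto simp: tuples_mem)

text \<open>Faces only drop or multiply entries, so they commute with a homomorphism applied
  entrywise; the one summand twisted by the first entry is covered by
  \<open>act_compat\<close>.\<close>

lemma coboundary_pullback:
  assumes \<sigma>: "\<sigma> \<in> cochains H B n"
  shows "coboundary G A act n (pullback G n p \<sigma>) = pullback G (n + 1) p (coboundary H B actB n \<sigma>)"
proof (rule cochain_eqI[of _ G A "n + 1"])
  fix g assume g: "g \<in> tuples G (n + 1)"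
  define q where "q = (\<lambda>j\<in>{1..n + 1}. p (g j))"
  have q: "q \<in> tuples H (n + 1)"
    unfolding q_def using g by (rule map_tuple)
  have face: "pullback G n p \<sigma> (face G n i g) = \<sigma> (face H n i q)" for i
    using G.face_tuple[OF g] by (simp add: pullback_def face_map[OF g] q_def del: One_nat_def)
  have \<sigma>_face: "\<sigma> (face H n i q) \<in> carrier B" for i
    using \<sigma> H.face_tuple[OF q] by (rule cochain_mem)
  have "g 1 \<in> carrier G"
    using g by (rule tuples_mem) simp
  then have act: "act (g 1) (\<sigma> (face H n 0 q)) = actB (q 1) (\<sigma> (face H n 0 q))"
    using \<sigma>_face by (simp add: act_compat q_def)
  have "finprod B (\<lambda>i. \<sigma> (face H n i q) [^]\<^bsub>B\<^esub> ((- 1) ^ i :: int)) {1..n} =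
      finprod A (\<lambda>i. \<sigma> (face H n i q) [^]\<^bsub>A\<^esub> ((- 1) ^ i :: int)) {1..n}"
    using \<sigma>_face H.A.int_pow_closed by (subst B_finprod) (auto simp: B_int_pow)
  then have "coboundary H B actB n \<sigma> q = coboundary G A act n (pullback G n p \<sigma>) g"
    using g q by (simp add: coboundary_def face act B_mult B_int_pow \<sigma>_face del: One_nat_def)
  then show "coboundary G A act n (pullback G n p \<sigma>) g =
      pullback G (n + 1) p (coboundary H B actB n \<sigma>) g"
    using g unfolding q_def pullback_def[of G "n + 1"] by simp
qed (use \<sigma> in \<open>auto intro!: G.coboundary_closed[simplified] H.coboundary_closed[simplified] pullback_closed\<close>)

lemma adj_act_pullback:
  assumes \<sigma>: "\<sigma> \<in> cochains H B n" and i: "i \<in> {1..n}"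
  shows "adj_act G A act n i (pullback G n p \<sigma>) = pullback G n p (adj_act H B actB n i \<sigma>)"
proof (rule cochain_eqI[of _ G A n])
  fix g assume g: "g \<in> tuples G n"
  define q where "q = (\<lambda>j\<in>{1..n}. p (g j))"
  have q: "q \<in> tuples H n"
    unfolding q_def using g by (rule map_tuple)
  have args: "pullback G n p \<sigma> (adj_args G n i g) = \<sigma> (adj_args H n i q)"
    using G.adj_args_tuple[OF g i] by (simp add: pullback_def adj_args_map[OF g i] q_def del: One_nat_def)
  have \<sigma>_args: "\<sigma> (adj_args H n i q) \<in> carrier B"
    using \<sigma> H.adj_args_tuple[OF q i] by (rule cochain_mem)
  have one: "1 \<in> {1..n}"
    using i by auto
  have "act (g 1) (\<sigma> (adj_args H n i q)) = actB (q 1) (\<sigma> (adj_args H n i q))"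
    using \<sigma>_args tuples_mem[OF g one] one by (simp add: act_compat q_def)
  \<comment> \<open>\<open>B_inv\<close> compares inverses only on the carrier of \<open>B\<close>;
    for \<open>i = 1\<close> the value under the sign is this one.\<close>
  moreover have "actB (q 1) (\<sigma> (adj_args H n i q)) \<in> carrier B"
    using \<sigma>_args tuples_mem[OF q one] by (simp add: H.act_closed)
  ultimately have "adj_act H B actB n i \<sigma> q = adj_act G A act n i (pullback G n p \<sigma>) g"
    using g q \<sigma>_args args by (cases "i = 1") (simp_all add: adj_act_def B_inv)
  then show "adj_act G A act n i (pullback G n p \<sigma>) g = pullback G n p (adj_act H B actB n i \<sigma>) g"
    using g unfolding q_def pullback_def[of G n] by simp
qed (use \<sigma> i in \<open>auto intro!: G.adj_act_closed H.adj_act_closed pullback_closed\<close>)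

lemma pullback_one: "pullback G n p \<one>\<^bsub>cochain_group H B n\<^esub> = \<one>\<^bsub>cochain_group G A n\<^esub>"
  by (auto simp: pullback_def cochain_group_def map_tuple B_one simp del: One_nat_def intro!: restrict_ext)

section \<open>Pullback of symmetric cocycles and coboundaries\<close>

context
  fixes C
  assumes C: "\<And>n \<sigma>. \<sigma> \<in> cochains H B n \<Longrightarrow> pullback G n p \<sigma> \<in> C n"
begin

text \<open>The target family \<open>C\<close> is the continuous cochains when pulling back to
  \<open>G\<close>, and all cochains when pulling back to another quotient.\<close>

lemma pullback_sym_cochains:
  assumes "\<sigma> \<in> carrier (sym_cochains H B actB (cochains H B) n)"
  shows "pullback G n p \<sigma> \<in> carrier (sym_cochains G A act C n)"
  using assms by (simp add: carrier_sym_cochains C adj_act_pullback)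

lemma pullback_sym_cocycles:
  assumes "\<sigma> \<in> carrier (sym_cocycles H B actB (cochains H B) n)"
  shows "pullback G n p \<sigma> \<in> carrier (sym_cocycles G A act C n)"
proof -
  have "\<sigma> \<in> cochains H B n"
    using assms by (simp add: carrier_sym_cocycles carrier_sym_cochains)
  then show ?thesis
    using assms pullback_sym_cochains pullback_one[of "n + 1"]
    by (simp add: carrier_sym_cocycles coboundary_pullback[simplified])
qed

lemma pullback_sym_coboundaries:
  assumes "\<sigma> \<in> sym_coboundaries H B actB (cochains H B) n"
  shows "pullback G n p \<sigma> \<in> sym_coboundaries G A act C n"
proof (cases n)
  case 0
  then show ?thesis
    using assms pullback_one[of 0] by (simp add: sym_coboundaries_def sym_cochains_def cochain_group_def)
next
  case (Suc m)
  then obtain \<tau> where \<tau>: "\<tau> \<in> carrier (sym_cochains H B actB (cochains H B) m)"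
    "\<sigma> = coboundary H B actB m \<tau>"
    using assms by (auto simp: sym_coboundaries_def)
  then have "pullback G n p \<sigma> = coboundary G A act m (pullback G m p \<tau>)"
    using Suc by (simp add: coboundary_pullback carrier_sym_cochains)
  then show ?thesis
    using Suc pullback_sym_cochains[OF \<tau>(1)] by (auto simp: sym_coboundaries_def)
qed

end

section \<open>Descent along a surjective homomorphism\<close>

context
  assumes p_surj: "p ` carrier G = carrier H"
begin

lemma lift_tuple:
  assumes q: "q \<in> tuples H n"
  obtains g where "g \<in> tuples G n" "(\<lambda>j\<in>{1..n}. p (g j)) = q"
proof -
  have "\<forall>j\<in>{1..n}. \<exists>x\<in>carrier G. p x = q j"
  proof
    fix j assume "j \<in> {1..n}"
    then have "q j \<in> p ` carrier G"
      using tuples_mem[OF q] unfolding p_surj by blast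
    then show "\<exists>x\<in>carrier G. p x = q j"
      by auto
  qed
  then obtain g where g: "\<And>j. j \<in> {1..n} \<Longrightarrow> g j \<in> carrier G \<and> p (g j) = q j"
    by metis
  have "(\<lambda>j\<in>{1..n}. p ((\<lambda>j\<in>{1..n}. g j) j)) = q"
    using q g unfolding tuples_def by (intro extensionalityI[of _ "{1..n}"]) (auto simp: PiE_def)
  moreover have "(\<lambda>j\<in>{1..n}. g j) \<in> tuples G n"
    using g by (intro tuplesI) auto
  ultimately show ?thesis
    using that by blast
qed

text \<open>Every tuple of \<open>H\<close> lifts entry by entry to \<open>G\<close>, so the
  pullback records every value of the cochain.\<close>

lemma pullback_inj: "inj_on (pullback G n p) (cochains H B n)"
proof (intro inj_onI cochain_eqI[of _ H B n])
  fix \<sigma> \<tau> q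
  assume eq: "pullback G n p \<sigma> = pullback G n p \<tau>" and "q \<in> tuples H n"
  then obtain g where "g \<in> tuples G n" "(\<lambda>j\<in>{1..n}. p (g j)) = q"
    using lift_tuple by blast
  then show "\<sigma> q = \<tau> q"
    using fun_cong[OF eq, of g] by (simp add: pullback_def)
qed

text \<open>The two sides of the invariance equation have equal pullbacks, and pullback is
  injective. Only the symmetry is carried down, so \<open>C\<close> may be any family.\<close>

lemma sym_cochains_of_pullback:
  assumes \<sigma>: "\<sigma> \<in> cochains H B n" and "pullback G n p \<sigma> \<in> carrier (sym_cochains G A act C n)"
  shows "\<sigma> \<in> carrier (sym_cochains H B actB (cochains H B) n)"
proof -
  have "adj_act H B actB n i \<sigma> = \<sigma>" if i: "i \<in> {1..n}" for i
    using assms i by (intro inj_onD[OF pullback_inj])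
      (simp_all add: carrier_sym_cochains adj_act_pullback[symmetric] H.adj_act_closed)
  then show ?thesis
    using \<sigma> by (simp add: carrier_sym_cochains)
qed

lemma sym_cocycles_of_pullback:
  assumes \<sigma>: "\<sigma> \<in> cochains H B n" and z: "pullback G n p \<sigma> \<in> carrier (sym_cocycles G A act C n)"
  shows "\<sigma> \<in> carrier (sym_cocycles H B actB (cochains H B) n)"
proof -
  interpret M: comm_group "cochain_group H B (n + 1)"
    by (rule comm_group_cochain_group) unfold_locales
  have "pullback G (n + 1) p (coboundary H B actB n \<sigma>) = pullback G (n + 1) p \<one>\<^bsub>cochain_group H B (n + 1)\<^esub>"
    unfolding pullback_one using z \<sigma> by (simp add: carrier_sym_cocycles coboundary_pullback[symmetric, simplified])
  then have "coboundary H B actB n \<sigma> = \<one>\<^bsub>cochain_group H B (n + 1)\<^esub>"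
    using H.coboundary_closed[OF \<sigma>] M.one_closed
    by (intro inj_onD[OF pullback_inj]) (simp_all add: cochain_group_def)
  then show ?thesis
    using sym_cochains_of_pullback[OF \<sigma>, of C] z by (simp add: carrier_sym_cocycles)
qed

end

end

section \<open>Quotient modules\<close>

context G_module
begin

lemma carrier_fixed_points: "carrier (fixed_points A act U) = {a \<in> carrier A. \<forall>u\<in>U. act u a = a}"
  by (simp add: fixed_points_def)

lemma fixed_points_eq: "fixed_points A act U = A\<lparr>carrier := carrier (fixed_points A act U)\<rparr>"
  by (simp add: fixed_points_def)

lemma subgroup_fixed_points:
  assumes U: "U \<subseteq> carrier G"
  shows "subgroup (carrier (fixed_points A act U)) A"
proof -
  have hom: "group_hom A A (act u)" if "u \<in> U" for u
    using act_hom[of u] that U by unfold_locales auto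
  show ?thesis
    unfolding carrier_fixed_points
    by (rule A.subgroupI)
      (auto simp: group_hom.hom_inv[OF hom] group_hom.hom_mult[OF hom]
        intro!: exI[of _ "\<one>\<^bsub>A\<^esub>"] group_hom.hom_one[OF hom])
qed

text \<open>Normality enters through \<open>u g = g (g^-1 u g)\<close>: moving \<open>u\<close> past
  \<open>g\<close> leaves a conjugate in \<open>U\<close>, which fixes \<open>a\<close>.\<close>

lemma act_fixed_points:
  assumes U: "U \<lhd> G" and g: "g \<in> carrier G" and a: "a \<in> carrier (fixed_points A act U)"
  shows "act g a \<in> carrier (fixed_points A act U)"
proof -
  interpret U: normal U G by fact
  have aA: "a \<in> carrier A"
    using a by (simp add: carrier_fixed_points)
  have "act u (act g a) = act g a" if u: "u \<in> U" for u
  proof -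
    have u': "inv\<^bsub>G\<^esub> g \<otimes>\<^bsub>G\<^esub> u \<otimes>\<^bsub>G\<^esub> g \<in> U"
      using g u by (rule U.inv_op_closed1)
    have "u \<otimes>\<^bsub>G\<^esub> g = g \<otimes>\<^bsub>G\<^esub> (inv\<^bsub>G\<^esub> g \<otimes>\<^bsub>G\<^esub> u \<otimes>\<^bsub>G\<^esub> g)"
      using g u by (simp add: G.m_assoc[symmetric])
    then have "act u (act g a) = act g (act (inv\<^bsub>G\<^esub> g \<otimes>\<^bsub>G\<^esub> u \<otimes>\<^bsub>G\<^esub> g) a)"
      using g u u' aA by (metis act_mult U.mem_carrier)
    then show ?thesis
      using a u' by (simp add: carrier_fixed_points)
  qed
  then show ?thesis
    using g aA by (simp add: carrier_fixed_points act_closed)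
qed

text \<open>Elements of \<open>G Mod U\<close> are right cosets, so a representative is
  \<open>h = u g\<close> and \<open>h a = u (g a)\<close>. Independence of \<open>h\<close>
  therefore rests on \<open>g a\<close>, and not just \<open>a\<close>, being fixed by
  \<open>U\<close>.\<close>

lemma quotient_act_coset:
  assumes U: "U \<lhd> G" and g: "g \<in> carrier G" and a: "a \<in> carrier (fixed_points A act U)"
  shows "quotient_act A act U (U #>\<^bsub>G\<^esub> g) a = act g a"
proof -
  interpret U: normal U G by fact
  have ga: "act g a \<in> carrier (fixed_points A act U)"
    using assms by (rule act_fixed_points)
  have "act h a = act g a" if h: "h \<in> U #>\<^bsub>G\<^esub> g" for h
  proof -
    obtain u where u: "u \<in> U" "h = u \<otimes>\<^bsub>G\<^esub> g"
      using h by (auto simp: r_coset_def)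
    then have "act h a = act u (act g a)"
      using g a by (simp add: act_mult carrier_fixed_points)
    then show ?thesis
      using ga u(1) by (simp add: carrier_fixed_points)
  qed
  then have "the_elem ((\<lambda>h. act h a) ` (U #>\<^bsub>G\<^esub> g)) = act g a"
    using G.rcos_self[OF g U.is_subgroup] by (intro the_elem_image_unique) blast+
  then show ?thesis
    using a by (simp add: quotient_act_def)
qed

lemma quotient_module:
  assumes U: "U \<lhd> G"
  shows "G_module (G Mod U) (fixed_points A act U) (quotient_act A act U)"
proof -
  interpret U: normal U G by fact
  have S: "subgroup (carrier (fixed_points A act U)) A"
    using U.subset by (rule subgroup_fixed_points)
  have mem: "a \<in> carrier A" if "a \<in> carrier (fixed_points A act U)" for a
    using that by (simp add: carrier_fixed_points)
  have mult: "a \<otimes>\<^bsub>fixed_points A act U\<^esub> b = a \<otimes>\<^bsub>A\<^esub> b" for a b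
    by (simp add: fixed_points_def)
  have "comm_group (fixed_points A act U)"
    by (subst fixed_points_eq) (rule A.comm_group_subgroup[OF S])
  then show ?thesis
  proof (intro G_module.intro G_module_axioms.intro U.factorgroup_is_group)
    fix Q assume "Q \<in> carrier (G Mod U)"
    then obtain g where "g \<in> carrier G" "Q = U #>\<^bsub>G\<^esub> g"
      by (auto simp: carrier_FactGroup)
    then show "quotient_act A act U Q \<in> hom (fixed_points A act U) (fixed_points A act U)"
      using subgroup.m_closed[OF S] U
      by (intro homI) (simp_all add: quotient_act_coset act_fixed_points mult hom_mult[OF act_hom] mem)
  next
    fix a assume "a \<in> carrier (fixed_points A act U)"
    then show "quotient_act A act U \<one>\<^bsub>G Mod U\<^esub> a = a"
      using quotient_act_coset[OF U G.one_closed] by (simp add: U.subset act_one mem G.coset_mult_one)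
  next
    fix P Q a
    assume "P \<in> carrier (G Mod U)" "Q \<in> carrier (G Mod U)" and a: "a \<in> carrier (fixed_points A act U)"
    then obtain g h where "g \<in> carrier G" "P = U #>\<^bsub>G\<^esub> g" "h \<in> carrier G" "Q = U #>\<^bsub>G\<^esub> h"
      by (auto simp: carrier_FactGroup)
    then show "quotient_act A act U (P \<otimes>\<^bsub>G Mod U\<^esub> Q) a = quotient_act A act U P (quotient_act A act U Q a)"
      using a U by (simp add: U.rcos_sum quotient_act_coset act_fixed_points act_mult mem)
  qed
qed

lemma quotient_pullback:
  assumes U: "U \<lhd> G"
  shows "module_pullback G A act (G Mod U) (fixed_points A act U) (quotient_act A act U) (\<lambda>g. U #>\<^bsub>G\<^esub> g)"
proof -
  interpret U: normal U G by fact
  show ?thesis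
    by (intro module_pullback.intro module_pullback_axioms.intro quotient_module U U.r_coset_hom_Mod
        subgroup_fixed_points U.subset fixed_points_eq quotient_act_coset[symmetric] G_module_axioms)
qed

text \<open>Since \<open>V\<close> absorbs \<open>U\<close>, the set product occurring in
  \<open>inflation\<close> is the canonical projection from \<open>G/U\<close> to
  \<open>G/V\<close>.\<close>

lemma set_mult_coset:
  assumes U: "U \<lhd> G" and V: "V \<lhd> G" and "U \<subseteq> V" and g: "g \<in> carrier G"
  shows "V <#>\<^bsub>G\<^esub> (U #>\<^bsub>G\<^esub> g) = V #>\<^bsub>G\<^esub> g"
proof -
  interpret U: normal U G by fact
  interpret V: normal V G by fact
  have "V <#>\<^bsub>G\<^esub> U = V"
  proof
    show "V <#>\<^bsub>G\<^esub> U \<subseteq> V"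
      using \<open>U \<subseteq> V\<close> by (auto simp: set_mult_def)
    show "V \<subseteq> V <#>\<^bsub>G\<^esub> U"
    proof
      fix v assume "v \<in> V"
      then have "v = v \<otimes>\<^bsub>G\<^esub> \<one>\<^bsub>G\<^esub>"
        by simp
      then show "v \<in> V <#>\<^bsub>G\<^esub> U"
        using \<open>v \<in> V\<close> U.one_closed unfolding set_mult_def by blast
    qed
  qed
  then show ?thesis
    using g by (metis G.setmult_rcos_assoc U.subset V.subset)
qed

lemma inflation_pullback:
  assumes U: "U \<lhd> G" and V: "V \<lhd> G" and UV: "U \<subseteq> V"
  shows "module_pullback (G Mod U) (fixed_points A act U) (quotient_act A act U)
    (G Mod V) (fixed_points A act V) (quotient_act A act V) (\<lambda>Q. V <#>\<^bsub>G\<^esub> Q)"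
proof -
  interpret U: normal U G by fact
  interpret V: normal V G by fact
  have sub: "carrier (fixed_points A act V) \<subseteq> carrier (fixed_points A act U)"
    using UV by (auto simp: carrier_fixed_points)
  have "subgroup (carrier (fixed_points A act V)) (fixed_points A act U)"
    by (subst fixed_points_eq) (intro A.subgroup_incl subgroup_fixed_points U.subset V.subset sub)
  then show ?thesis
    using UV sub
    by (intro module_pullback.intro module_pullback_axioms.intro quotient_module U V homI)
      (auto simp: fixed_points_def carrier_FactGroup set_mult_coset[OF U V] U.rcos_sum V.rcos_sum
        quotient_act_coset[OF U] quotient_act_coset[OF V])
qed

lemma inflation_eq: "inflation G n V U = pullback (G Mod U) n (\<lambda>Q. V <#>\<^bsub>G\<^esub> Q)"
  by (rule ext) (simp add: inflation_def pullback_def)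

text \<open>Transitivity of inflation: the maps from the levels \<open>G/U\<close> into the cochains
  of \<open>G\<close> form a cocone over the system.\<close>

lemma pullback_inflation:
  assumes U: "U \<lhd> G" and V: "V \<lhd> G" and UV: "U \<subseteq> V"
  shows "pullback G n (\<lambda>g. U #>\<^bsub>G\<^esub> g) (inflation G n V U \<sigma>) = pullback G n (\<lambda>g. V #>\<^bsub>G\<^esub> g) \<sigma>"
proof -
  interpret U: module_pullback G A act "G Mod U" "fixed_points A act U" "quotient_act A act U"
    "\<lambda>g. U #>\<^bsub>G\<^esub> g"
    using U by (rule quotient_pullback)
  have "(\<lambda>j\<in>{1..n}. V <#>\<^bsub>G\<^esub> (\<lambda>j\<in>{1..n}. U #>\<^bsub>G\<^esub> g j) j) = (\<lambda>j\<in>{1..n}. V #>\<^bsub>G\<^esub> g j)"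
    if "g \<in> tuples G n" for g
    using that tuples_mem[OF that] by (intro restrict_ext) (simp add: set_mult_coset[OF U V UV])
  then show ?thesis
    unfolding pullback_def inflation_def
    by (intro restrict_ext) (use U.map_tuple in simp)
qed

end

section \<open>Open normal subgroups of compact groups\<close>

text \<open>The tube lemma: the complement is the image of a closed set under the projection along
  the compact factor \<open>K\<close>, which is a closed map.\<close>

lemma openin_forall_compact:
  assumes "compact_space K" and W: "openin (prod_topology S K) W"
  shows "openin S {x \<in> topspace S. \<forall>y\<in>topspace K. (x, y) \<in> W}"
proof -
  have "closedin S (fst ` (topspace (prod_topology S K) - W))"
    using closed_map_fst[OF assms(1)] W unfolding closed_map_def by blast
  moreover have "topspace S - fst ` (topspace (prod_topology S K) - W) =
      {x \<in> topspace S. \<forall>y\<in>topspace K. (x, y) \<in> W}"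
    by force
  ultimately show ?thesis
    by (metis openin_closedin_eq closedin_def)
qed

text \<open>The set is the union over \<open>d\<close> of the open sets on which both maps take the
  value \<open>d\<close>. It makes invariance conditions on a cochain with discrete values
  open.\<close>

lemma openin_Collect_eq_discrete:
  assumes f: "continuous_map S (discrete_topology D) f" and g: "continuous_map S (discrete_topology D) g"
  shows "openin S {x \<in> topspace S. f x = g x}"
proof -
  have "openin S {x \<in> topspace S. f x \<in> {d}}" "openin S {x \<in> topspace S. g x \<in> {d}}" if "d \<in> D" for d
    using that by (intro openin_continuous_map_preimage[OF f] openin_continuous_map_preimage[OF g]; simp)+
  then have "openin S (\<Union>d\<in>D. {x \<in> topspace S. f x \<in> {d}} \<inter> {x \<in> topspace S. g x \<in> {d}})"
    by blast
  moreover have "g x \<in> D" if "x \<in> topspace S" for x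
    using continuous_map_image_subset_topspace[OF g] that by auto
  then have "(\<Union>d\<in>D. {x \<in> topspace S. f x \<in> {d}} \<inter> {x \<in> topspace S. g x \<in> {d}}) =
      {x \<in> topspace S. f x = g x}"
    by auto
  ultimately show ?thesis by simp
qed

lemma openin_Collect_ball_finite:
  assumes "finite I" "\<And>i. i \<in> I \<Longrightarrow> openin S {x \<in> topspace S. P i x}"
  shows "openin S {x \<in> topspace S. \<forall>i\<in>I. P i x}"
proof -
  \<comment> \<open>The factor \<open>topspace S\<close> takes care of an empty \<open>I\<close>,
    which occurs for cochains of degree \<open>0\<close>.\<close>
  have "{x \<in> topspace S. \<forall>i\<in>I. P i x} = (\<Inter>i\<in>I. {x \<in> topspace S. P i x}) \<inter> topspace S"
    by blast
  then show ?thesis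
    using assms by (simp only: openin_INT)
qed

lemma continuous_map_fun_upd:
  assumes f: "continuous_map S (product_topology Ts I) f" and g: "continuous_map S (Ts j) g" and j: "j \<in> I"
  shows "continuous_map S (product_topology Ts I) (\<lambda>x. (f x)(j := g x))"
proof -
  have "continuous_map S (Ts i) (\<lambda>x. ((f x)(j := g x)) i)" if "i \<in> I" for i
    using f g that by (cases "i = j") (simp_all add: continuous_map_componentwise)
  then show ?thesis
    using f j unfolding continuous_map_componentwise by (fastforce simp: extensional_def)
qed

section \<open>Open subgroups of topological groups\<close>

context topological_group
begin

lemma continuous_map_group_mult:
  assumes "continuous_map S T f" "continuous_map S T g"
  shows "continuous_map S T (\<lambda>x. f x \<otimes> g x)"
  using continuous_map_compose[OF continuous_map_pairedI[OF assms] continuous_mult]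
  by (simp add: o_def)

lemma continuous_map_group_inv:
  assumes "continuous_map S T f"
  shows "continuous_map S T (\<lambda>x. inv (f x))"
  using continuous_map_compose[OF assms continuous_inv] by (simp add: o_def)

lemma openin_r_coset:
  assumes U: "subgroup U G" "openin T U" and g: "g \<in> carrier G"
  shows "openin T (U #> g)"
proof -
  have "continuous_map T T (\<lambda>h. h \<otimes> inv g)"
    using g by (intro continuous_map_group_mult) (simp_all add: topspace_eq_carrier)
  then have "openin T {h \<in> topspace T. h \<otimes> inv g \<in> U}"
    using U(2) by (rule openin_continuous_map_preimage)
  moreover have "{h \<in> topspace T. h \<otimes> inv g \<in> U} = U #> g"
    using subgroup.rcos_module[OF U(1) is_group g] subgroup.subset[OF U(1)] g
    by (auto simp: topspace_eq_carrier r_coset_def m_assoc)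
  ultimately show ?thesis by simp
qed

lemma open_normal_subgroups_Int:
  assumes "U \<in> open_normal_subgroups G T" "V \<in> open_normal_subgroups G T"
  shows "U \<inter> V \<in> open_normal_subgroups G T"
  using assms by (auto simp: open_normal_subgroups_def normal_inv_iff subgroups_Inter_pair)

text \<open>Supplies a level at which the only coboundary of degree \<open>0\<close>, the neutral
  cochain, is found.\<close>

lemma carrier_open_normal: "carrier G \<in> open_normal_subgroups G T"
  using openin_topspace[of T]
  by (auto simp: open_normal_subgroups_def topspace_eq_carrier normal_inv_iff subgroup_self)

text \<open>The normal core of \<open>V\<close> is a possibly infinite intersection of open
  conjugates. It is open because membership is an open condition on pairs, quantified over the
  compact group of conjugating elements.\<close>

lemma open_normal_core:
  assumes compact: "compact_space T" and V: "subgroup V G" "openin T V"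
  obtains U where "U \<in> open_normal_subgroups G T" "U \<subseteq> V"
proof -
  have inv_cancel: "inv x \<otimes> (x \<otimes> y) = y" if "x \<in> carrier G" "y \<in> carrier G" for x y
    using that by (simp add: m_assoc[symmetric])
  define U where "U = {u \<in> carrier G. \<forall>x\<in>carrier G. x \<otimes> u \<otimes> inv x \<in> V}"
  \<comment> \<open>The first coordinate is the element tested for membership in \<open>U\<close>,
    the second the conjugating element that gets quantified.\<close>
  have "continuous_map (prod_topology T T) T (\<lambda>p. snd p \<otimes> fst p \<otimes> inv (snd p))"
    by (intro continuous_map_group_mult continuous_map_group_inv continuous_map_fst continuous_map_snd)
  then have "openin (prod_topology T T)
      {p \<in> topspace (prod_topology T T). snd p \<otimes> fst p \<otimes> inv (snd p) \<in> V}"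
    using V(2) by (rule openin_continuous_map_preimage)
  from openin_forall_compact[OF compact this] have "openin T U"
    by (simp add: U_def topspace_eq_carrier cong: conj_cong)
  moreover have "subgroup U G"
  proof (rule subgroupI)
    show "U \<subseteq> carrier G"
      by (auto simp: U_def)
    show "U \<noteq> {}"
      using subgroup.one_closed[OF V(1)] by (auto simp: U_def intro!: exI[of _ \<one>])
    show "inv u \<in> U" if u: "u \<in> U" for u
    proof -
      have "x \<otimes> inv u \<otimes> inv x \<in> V" if x: "x \<in> carrier G" for x
      proof -
        have "inv (x \<otimes> u \<otimes> inv x) \<in> V"
          using u x subgroup.m_inv_closed[OF V(1)] by (simp add: U_def)
        then show ?thesis
          using u x by (simp add: U_def inv_mult_group m_assoc)
      qed
      then show ?thesis
        using u by (simp add: U_def)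
    qed
    show "u \<otimes> v \<in> U" if u: "u \<in> U" and v: "v \<in> U" for u v
    proof -
      have "x \<otimes> (u \<otimes> v) \<otimes> inv x \<in> V" if x: "x \<in> carrier G" for x
      proof -
        have uv: "u \<in> carrier G" "v \<in> carrier G"
          using u v by (simp_all add: U_def)
        have "(x \<otimes> u \<otimes> inv x) \<otimes> (x \<otimes> v \<otimes> inv x) \<in> V"
          using u v x subgroup.m_closed[OF V(1)] by (simp add: U_def)
        also have "(x \<otimes> u \<otimes> inv x) \<otimes> (x \<otimes> v \<otimes> inv x) = x \<otimes> (u \<otimes> v) \<otimes> inv x"
          using uv x inv_cancel[of x "v \<otimes> inv x"] by (simp add: m_assoc)
        finally show ?thesis .
      qed
      then show ?thesis
        using u v by (simp add: U_def)
    qed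
  qed
  moreover have "y \<otimes> u \<otimes> inv y \<in> U" if y: "y \<in> carrier G" and u: "u \<in> U" for y u
  proof -
    have uG: "u \<in> carrier G"
      using u by (simp add: U_def)
    have "x \<otimes> (y \<otimes> u \<otimes> inv y) \<otimes> inv x \<in> V" if x: "x \<in> carrier G" for x
    proof -
      have "(x \<otimes> y) \<otimes> u \<otimes> inv (x \<otimes> y) \<in> V"
        using u x y by (simp add: U_def)
      then show ?thesis
        using x y uG by (simp add: inv_mult_group m_assoc)
    qed
    then show ?thesis
      using y uG by (simp add: U_def)
  qed
  ultimately have "U \<in> open_normal_subgroups G T"
    by (simp add: open_normal_subgroups_def normal_inv_iff)
  moreover have "U \<subseteq> V"
  proof
    fix u assume "u \<in> U"
    then have "\<one> \<otimes> u \<otimes> inv \<one> \<in> V" "u \<in> carrier G"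
      unfolding U_def by blast+
    then show "u \<in> V"
      by simp
  qed
  ultimately show ?thesis
    using that by blast
qed

end

section \<open>Continuous cochains with discrete coefficients\<close>

context discrete_module
begin

text \<open>Multiplication in \<open>AutoGroup A\<close> is composition restricted to the carrier,
  so evaluating the homomorphism property at a point gives the laws of an action.\<close>

sublocale M: G_module G A act
proof
  have Aut: "group (AutoGroup A)"
    by (rule A.AutoGroup)
  then interpret \<rho>: group_hom G "AutoGroup A" act
    by (intro group_hom.intro group_hom_axioms.intro G.is_group act_hom)
  have act_auto: "act g \<in> auto A" if "g \<in> carrier G" for g
    using \<rho>.hom_closed[OF that] by (simp add: AutoGroup_def)
  show "act g \<in> hom A A" if "g \<in> carrier G" for g
    using act_auto[OF that] by (simp add: auto_def)
  show "act \<one>\<^bsub>G\<^esub> a = a" if "a \<in> carrier A" for a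
    using \<rho>.hom_one that by (simp add: AutoGroup_def BijGroup_def)
  show "act (g \<otimes>\<^bsub>G\<^esub> h) a = act g (act h a)"
    if "g \<in> carrier G" "h \<in> carrier G" "a \<in> carrier A" for g h a
    using \<rho>.hom_mult[OF that(1,2)] act_auto[OF that(1)] act_auto[OF that(2)] that(3)
    by (simp add: AutoGroup_def BijGroup_def auto_def compose_def)
qed

lemma topspace_tuples: "topspace (product_topology (\<lambda>j. T) {1..n}) = tuples G n"
  by (simp add: tuples_def G.topspace_eq_carrier)

lemma subgroup_cont_cochains: "subgroup (cont_cochains G T A TA n) (cochain_group G A n)"
proof -
  interpret C: comm_group "cochain_group G A n"
    by (rule comm_group_cochain_group) unfold_locales
  \<comment> \<open>Cochains are extensional, while continuity sees only the values on the
    topological space, which is \<open>tuples G n\<close>.\<close>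
  have cont_restrict: "continuous_map (product_topology (\<lambda>j. T) {1..n}) TA (\<lambda>g\<in>tuples G n. f g)"
    if "continuous_map (product_topology (\<lambda>j. T) {1..n}) TA f" for f
    using that by (rule continuous_map_eq) (simp only: topspace_tuples restrict_apply')
  show ?thesis
  proof (rule C.subgroupI)
    show "cont_cochains G T A TA n \<subseteq> carrier (cochain_group G A n)"
      by (auto simp: cont_cochains_def cochain_group_def)
    have "(\<lambda>g\<in>tuples G n. \<one>\<^bsub>A\<^esub>) \<in> cont_cochains G T A TA n"
      by (simp add: cont_cochains_def cont_restrict A.topspace_eq_carrier restrict_cochain del: One_nat_def)
    then show "cont_cochains G T A TA n \<noteq> {}"
      by blast
    show "inv\<^bsub>cochain_group G A n\<^esub> \<sigma> \<in> cont_cochains G T A TA n" if "\<sigma> \<in> cont_cochains G T A TA n" for \<sigma>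
    proof -
      have \<sigma>: "\<sigma> \<in> cochains G A n" and cont: "continuous_map (product_topology (\<lambda>j. T) {1..n}) TA \<sigma>"
        using that by (simp_all add: cont_cochains_def)
      have "(\<lambda>g\<in>tuples G n. inv\<^bsub>A\<^esub> \<sigma> g) \<in> cochains G A n"
        using cochain_mem[OF \<sigma>] by (intro restrict_cochain A.inv_closed)
      then have "(\<lambda>g\<in>tuples G n. inv\<^bsub>A\<^esub> \<sigma> g) \<in> cont_cochains G T A TA n"
        using cont_restrict[OF A.continuous_map_group_inv[OF cont]] by (simp add: cont_cochains_def)
      with \<sigma> show ?thesis
        by (simp add: inv_cochain_group A.comm_group_axioms)
    qed
    show "\<sigma> \<otimes>\<^bsub>cochain_group G A n\<^esub> \<tau> \<in> cont_cochains G T A TA n"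
      if "\<sigma> \<in> cont_cochains G T A TA n" "\<tau> \<in> cont_cochains G T A TA n" for \<sigma> \<tau>
      using that unfolding cont_cochains_def cochain_group_def
      by (simp add: cont_restrict A.continuous_map_group_mult M.cochain_mult del: One_nat_def)
  qed
qed

text \<open>The pullback is constant on each box of cosets \<open>U g_j\<close>. Such a box is open
  because it has finitely many open sides, so the pullback is locally constant.\<close>

lemma pullback_cont_cochain:
  assumes U: "U \<in> open_normal_subgroups G T"
    and \<sigma>: "\<sigma> \<in> cochains (G Mod U) (fixed_points A act U) n"
  shows "pullback G n (\<lambda>g. U #>\<^bsub>G\<^esub> g) \<sigma> \<in> cont_cochains G T A TA n"
proof -
  let ?\<sigma> = "pullback G n (\<lambda>g. U #>\<^bsub>G\<^esub> g) \<sigma>"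
  have U': "U \<lhd> G" "openin T U" "subgroup U G"
    using U normal_imp_subgroup by (auto simp: open_normal_subgroups_def)
  interpret U: module_pullback G A act "G Mod U" "fixed_points A act U" "quotient_act A act U"
    "\<lambda>g. U #>\<^bsub>G\<^esub> g"
    using U'(1) by (rule M.quotient_pullback)
  have cochain: "?\<sigma> \<in> cochains G A n"
    using \<sigma> by (rule U.pullback_closed)
  have "openin (product_topology (\<lambda>j. T) {1..n}) {g \<in> tuples G n. ?\<sigma> g \<in> W}" for W
  \<comment> \<open>\<open>W\<close> is arbitrary since every subset of a discrete module is open; a
    box of cosets around each point lies in the preimage.\<close>
  proof (subst openin_subopen, intro ballI)
    fix g assume "g \<in> {g \<in> tuples G n. ?\<sigma> g \<in> W}"
    then have g: "g \<in> tuples G n" "?\<sigma> g \<in> W"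
      by auto
    define N where "N = (\<Pi>\<^sub>E j\<in>{1..n}. U #>\<^bsub>G\<^esub> g j)"
    have gj: "g j \<in> carrier G" if "j \<in> {1..n}" for j
      using g(1) that by (rule tuples_mem)
    have "openin (product_topology (\<lambda>j. T) {1..n}) N"
      unfolding N_def using U' gj by (simp add: openin_PiE G.openin_r_coset del: One_nat_def)
    moreover have "g \<in> N"
      using g(1) gj G.rcos_self[OF _ U'(3)] by (auto simp: N_def tuples_def simp del: One_nat_def)
    moreover have "N \<subseteq> {g \<in> tuples G n. ?\<sigma> g \<in> W}"
    proof
      fix h assume h: "h \<in> N"
      then have hj: "h j \<in> U #>\<^bsub>G\<^esub> g j" if "j \<in> {1..n}" for j
        using that by (auto simp: N_def)
      then have "h j \<in> carrier G" if "j \<in> {1..n}" for j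
        using that gj G.r_coset_subset_G[OF subgroup.subset[OF U'(3)]] by blast
      then have "h \<in> tuples G n"
        using h by (intro tuplesI) (auto simp: N_def PiE_def)
      moreover have "(\<lambda>j\<in>{1..n}. U #>\<^bsub>G\<^esub> h j) = (\<lambda>j\<in>{1..n}. U #>\<^bsub>G\<^esub> g j)"
        using G.repr_independence[OF hj gj U'(3)] by (intro restrict_ext) simp
      ultimately show "h \<in> {g \<in> tuples G n. ?\<sigma> g \<in> W}"
        using g by (simp add: pullback_def)
    qed
    ultimately show "\<exists>N. openin (product_topology (\<lambda>j. T) {1..n}) N \<and> g \<in> N \<and>
        N \<subseteq> {g \<in> tuples G n. ?\<sigma> g \<in> W}"
      by blast
  qed
  then have "continuous_map (product_topology (\<lambda>j. T) {1..n}) TA ?\<sigma>"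
    using cochain unfolding continuous_map_def topspace_tuples
    by (auto simp: discrete cochain_mem)
  then show ?thesis
    using cochain by (simp add: cont_cochains_def)
qed

text \<open>The \<open>v \<in> G\<close> for which translating a single entry by \<open>v\<close> never changes \<open>\<sigma>\<close> form a subgroup,
  which is open by compactness of \<open>G\<^sup>n\<close>; its normal core then gives \<open>U\<close>.\<close>

lemma cont_cochain_descends:
  assumes compact: "compact_space T" and \<sigma>: "\<sigma> \<in> cont_cochains G T A TA n"
  obtains U \<tau> where "U \<in> open_normal_subgroups G T"
    "\<tau> \<in> cochains (G Mod U) (fixed_points A act U) n" "pullback G n (\<lambda>g. U #>\<^bsub>G\<^esub> g) \<tau> = \<sigma>"
proof -
  let ?Tn = "product_topology (\<lambda>j. T) {1..n}"
  have cochain: "\<sigma> \<in> cochains G A n" and cont: "continuous_map ?Tn (discrete_topology (carrier A)) \<sigma>"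
    using \<sigma> by (simp_all add: cont_cochains_def discrete)
  have \<sigma>_mem: "\<sigma> g \<in> carrier A" if "g \<in> tuples G n" for g
    using cochain that by (rule cochain_mem)
  have upd: "g(j := v \<otimes>\<^bsub>G\<^esub> g j) \<in> tuples G n"
    if "g \<in> tuples G n" "v \<in> carrier G" "j \<in> {1..n}" for g v j
    using that by (intro tuplesI) (auto simp: tuples_def PiE_def extensional_def)
  \<comment> \<open>Translations are on the left because the cosets of \<open>G Mod U\<close> have
    the form \<open>U g\<close>. Moving one entry at a time keeps this a condition on a single
    \<open>v\<close>. The clause on \<open>act\<close> is what later places the values in the fixed
    points of \<open>U\<close>.\<close>
  define V where "V = {v \<in> carrier G. \<forall>g\<in>tuples G n.
    (\<forall>j\<in>{1..n}. \<sigma> (g(j := v \<otimes>\<^bsub>G\<^esub> g j)) = \<sigma> g) \<and> act v (\<sigma> g) = \<sigma> g}"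
  have V_upd: "\<sigma> (g(j := v \<otimes>\<^bsub>G\<^esub> g j)) = \<sigma> g" if "v \<in> V" "g \<in> tuples G n" "j \<in> {1..n}" for v g j
    using that unfolding V_def by blast
  have V_act: "act v (\<sigma> g) = \<sigma> g" if "v \<in> V" "g \<in> tuples G n" for v g
    using that unfolding V_def by blast
  have V_sub: "v \<in> carrier G" if "v \<in> V" for v
    using that unfolding V_def by blast
  have "openin T V"
  proof -
    let ?P = "prod_topology T ?Tn"
    have cont_snd: "continuous_map ?P (discrete_topology (carrier A)) (\<lambda>p. \<sigma> (snd p))"
      using continuous_map_compose[OF continuous_map_snd cont] by (simp add: o_def)
    have "openin ?P {p \<in> topspace ?P. \<sigma> ((snd p)(j := fst p \<otimes>\<^bsub>G\<^esub> snd p j)) = \<sigma> (snd p)}"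
      if j: "j \<in> {1..n}" for j
    proof (rule openin_Collect_eq_discrete[OF _ cont_snd])
      have "continuous_map ?P T (\<lambda>p. snd p j)"
        using continuous_map_snd[of T ?Tn] j unfolding continuous_map_componentwise by blast
      then have "continuous_map ?P T (\<lambda>p. fst p \<otimes>\<^bsub>G\<^esub> snd p j)"
        by (intro G.continuous_map_group_mult continuous_map_fst)
      then have "continuous_map ?P ?Tn (\<lambda>p. (snd p)(j := fst p \<otimes>\<^bsub>G\<^esub> snd p j))"
        using j by (intro continuous_map_fun_upd continuous_map_snd)
      from continuous_map_compose[OF this cont]
      show "continuous_map ?P (discrete_topology (carrier A))
          (\<lambda>p. \<sigma> ((snd p)(j := fst p \<otimes>\<^bsub>G\<^esub> snd p j)))"
        by (simp only: o_def)
    qed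
    then have "openin ?P {p \<in> topspace ?P. \<forall>j\<in>{1..n}. \<sigma> ((snd p)(j := fst p \<otimes>\<^bsub>G\<^esub> snd p j)) = \<sigma> (snd p)}"
      by (intro openin_Collect_ball_finite) auto
    \<comment> \<open>For a fixed tuple this is openness of the stabiliser of one value. Keeping the
      tuple as a variable lets compactness of \<open>?Tn\<close> treat all values at once.\<close>
    moreover have "openin ?P {p \<in> topspace ?P. act (fst p) (\<sigma> (snd p)) = \<sigma> (snd p)}"
    proof (rule openin_Collect_eq_discrete[OF _ cont_snd])
      have "continuous_map ?P (prod_topology T TA) (\<lambda>p. (fst p, \<sigma> (snd p)))"
        using cont_snd by (intro continuous_map_pairedI continuous_map_fst) (simp add: discrete)
      from continuous_map_compose[OF this continuous_act]
      show "continuous_map ?P (discrete_topology (carrier A)) (\<lambda>p. act (fst p) (\<sigma> (snd p)))"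
        by (simp add: o_def discrete)
    qed
    ultimately have "openin ?P ({p \<in> topspace ?P. \<forall>j\<in>{1..n}. \<sigma> ((snd p)(j := fst p \<otimes>\<^bsub>G\<^esub> snd p j)) = \<sigma> (snd p)}
        \<inter> {p \<in> topspace ?P. act (fst p) (\<sigma> (snd p)) = \<sigma> (snd p)})" (is "openin _ ?W")
      by (rule openin_Int)
    moreover have "compact_space ?Tn"
      using compact by (simp add: compact_space_product_topology)
    ultimately have "openin T {v \<in> topspace T. \<forall>g\<in>topspace ?Tn. (v, g) \<in> ?W}"
      by (intro openin_forall_compact)
    moreover have "{v \<in> topspace T. \<forall>g\<in>topspace ?Tn. (v, g) \<in> ?W} = V"
      unfolding topspace_tuples V_def topspace_prod_topology G.topspace_eq_carrier by auto
    ultimately show ?thesis by simp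
  qed
  moreover have "subgroup V G"
  proof (rule G.subgroupI)
    show "V \<subseteq> carrier G"
      using V_sub by blast
    have "\<one>\<^bsub>G\<^esub> \<in> V"
      unfolding V_def by (auto simp: M.act_one \<sigma>_mem tuples_mem simp del: One_nat_def)
    then show "V \<noteq> {}"
      by blast
    show "inv\<^bsub>G\<^esub> v \<in> V" if v: "v \<in> V" for v
    proof -
      have vG: "v \<in> carrier G" "inv\<^bsub>G\<^esub> v \<in> carrier G"
        using V_sub[OF v] by simp_all
      have "\<sigma> (g(j := inv\<^bsub>G\<^esub> v \<otimes>\<^bsub>G\<^esub> g j)) = \<sigma> g" if g: "g \<in> tuples G n" and j: "j \<in> {1..n}" for g j
      proof -
        have "g j \<in> carrier G"
          using g j by (rule tuples_mem)
        \<comment> \<open>The condition for \<open>v\<close> is applied to the tuple already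
          translated by the inverse of \<open>v\<close>; translating by \<open>v\<close> then
          returns \<open>g\<close>.\<close>
        then have "v \<otimes>\<^bsub>G\<^esub> (inv\<^bsub>G\<^esub> v \<otimes>\<^bsub>G\<^esub> g j) = g j"
          using vG by (simp add: G.m_assoc[symmetric])
        then show ?thesis
          using V_upd[OF v upd[OF g vG(2) j] j] by simp
      qed
      moreover have "act (inv\<^bsub>G\<^esub> v) (\<sigma> g) = \<sigma> g" if g: "g \<in> tuples G n" for g
        using V_act[OF v g] M.act_mult[OF vG(2,1) \<sigma>_mem[OF g]] M.act_one[OF \<sigma>_mem[OF g]] vG by simp
      ultimately show ?thesis
        using vG unfolding V_def by blast
    qed
    show "v \<otimes>\<^bsub>G\<^esub> w \<in> V" if v: "v \<in> V" and w: "w \<in> V" for v w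
    proof -
      have vw: "v \<in> carrier G" "w \<in> carrier G"
        using v w V_sub by auto
      have "\<sigma> (g(j := v \<otimes>\<^bsub>G\<^esub> w \<otimes>\<^bsub>G\<^esub> g j)) = \<sigma> g" if g: "g \<in> tuples G n" and j: "j \<in> {1..n}" for g j
        using V_upd[OF v upd[OF g vw(2) j] j] V_upd[OF w g j] vw tuples_mem[OF g j]
        by (simp add: G.m_assoc)
      moreover have "act (v \<otimes>\<^bsub>G\<^esub> w) (\<sigma> g) = \<sigma> g" if g: "g \<in> tuples G n" for g
        using V_act[OF v g] V_act[OF w g] M.act_mult[OF vw \<sigma>_mem[OF g]] by simp
      ultimately show ?thesis
        using vw unfolding V_def by blast
    qed
  qed
  ultimately obtain U where U: "U \<in> open_normal_subgroups G T" and UV: "U \<subseteq> V"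
    using G.open_normal_core[OF compact] by blast
  have UN: "U \<lhd> G"
    using U by (simp add: open_normal_subgroups_def)
  interpret U: module_pullback G A act "G Mod U" "fixed_points A act U" "quotient_act A act U"
    "\<lambda>g. U #>\<^bsub>G\<^esub> g"
    using UN by (rule M.quotient_pullback)
  have U_sub: "subgroup U G"
    using UN by (rule normal_imp_subgroup)
  have coset_const: "\<sigma> h = \<sigma> g"
    if g: "g \<in> tuples G n" and h: "h \<in> tuples G n" and gh: "\<And>j. j \<in> {1..n} \<Longrightarrow> h j \<in> U #>\<^bsub>G\<^esub> g j" for g h
  proof -
    \<comment> \<open>Pass from \<open>g\<close> to \<open>h\<close> by replacing entries one at a
      time; \<open>S\<close> is the set of positions already replaced, and each replacement is a
      translation by an element of \<open>V\<close>.\<close>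
    have "\<sigma> (\<lambda>j. if j \<in> S then h j else g j) = \<sigma> g" if "finite S" "S \<subseteq> {1..n}" for S
      using that
    proof (induction S rule: finite_induct)
      case (insert j S)
      define f where "f = (\<lambda>i. if i \<in> S then h i else g i)"
      have f: "f \<in> tuples G n"
        using g h by (intro tuplesI) (auto simp: f_def tuples_def PiE_def extensional_def)
      have j: "j \<in> {1..n}"
        using insert.prems by blast
      obtain u where u: "u \<in> U" "h j = u \<otimes>\<^bsub>G\<^esub> g j"
        using gh[OF j] by (auto simp: r_coset_def)
      have "f j = g j"
        using insert.hyps by (simp add: f_def)
      then have "(\<lambda>i. if i \<in> insert j S then h i else g i) = f(j := u \<otimes>\<^bsub>G\<^esub> f j)"
        using u by (auto simp: f_def)
      moreover have "u \<in> V"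
        using u(1) UV by blast
      ultimately have "\<sigma> (\<lambda>i. if i \<in> insert j S then h i else g i) = \<sigma> f"
        using V_upd[OF _ f j] by simp
      then show ?case
        using insert.IH insert.prems by (simp add: f_def)
    qed simp
    from this[of "{1..n}"] have "\<sigma> (\<lambda>j. if j \<in> {1..n} then h j else g j) = \<sigma> g"
      by simp
    \<comment> \<open>Outside \<open>{1..n}\<close> both tuples are \<open>undefined\<close>, so
      replacing all positions gives \<open>h\<close> itself.\<close>
    moreover have "(\<lambda>j. if j \<in> {1..n} then h j else g j) = h"
      using g h by (auto simp: tuples_def PiE_def extensional_def)
    ultimately show ?thesis by simp
  qed
  \<comment> \<open>Evaluate \<sigma> on arbitrarily chosen representatives; by
    \<open>coset_const\<close> the result is the value at any other lift.\<close>
  define \<tau> where "\<tau> = (\<lambda>q\<in>tuples (G Mod U) n. \<sigma> (\<lambda>j\<in>{1..n}. SOME x. x \<in> q j))"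
  have rep: "(SOME x. x \<in> U #>\<^bsub>G\<^esub> x') \<in> U #>\<^bsub>G\<^esub> x'" if "x' \<in> carrier G" for x'
    using G.rcos_self[OF that U_sub] by (rule someI)
  have rep_tuple: "(\<lambda>j\<in>{1..n}. SOME x. x \<in> U #>\<^bsub>G\<^esub> g j) \<in> tuples G n" if "g \<in> tuples G n" for g
    using rep tuples_mem[OF that] G.r_coset_subset_G[OF subgroup.subset[OF U_sub]]
    by (intro tuplesI) auto
  have eq: "\<tau> (\<lambda>j\<in>{1..n}. U #>\<^bsub>G\<^esub> g j) = \<sigma> g" if g: "g \<in> tuples G n" for g
  proof -
    have "\<tau> (\<lambda>j\<in>{1..n}. U #>\<^bsub>G\<^esub> g j) = \<sigma> (\<lambda>j\<in>{1..n}. SOME x. x \<in> U #>\<^bsub>G\<^esub> g j)"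
      unfolding \<tau>_def using U.map_tuple[OF g]
      by (simp del: One_nat_def) (intro arg_cong[of _ _ \<sigma>] restrict_ext, simp)
    also have "\<dots> = \<sigma> g"
      using rep tuples_mem[OF g] by (intro coset_const g rep_tuple) simp
    finally show ?thesis .
  qed
  have "\<tau> \<in> cochains (G Mod U) (fixed_points A act U) n"
  proof -
    \<comment> \<open>A value of \<tau> is a value of \<sigma> at a lift of \<open>q\<close>, and
      these are fixed by \<open>U\<close> because \<open>U\<close> lies in \<open>V\<close>.\<close>
    have "\<tau> q \<in> carrier (fixed_points A act U)" if q: "q \<in> tuples (G Mod U) n" for q
    proof -
      obtain g where g: "g \<in> tuples G n" "(\<lambda>j\<in>{1..n}. U #>\<^bsub>G\<^esub> g j) = q"
        using U.lift_tuple[OF carrier_FactGroup[symmetric] q] by blast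
      have "act u (\<sigma> g) = \<sigma> g" if "u \<in> U" for u
        using V_act[OF _ g(1)] UV that by blast
      then show ?thesis
        using eq[OF g(1)] \<sigma>_mem[OF g(1)] unfolding g(2) by (simp add: M.carrier_fixed_points)
    qed
    then show ?thesis
      unfolding \<tau>_def cochains_def by auto
  qed
  moreover have "pullback G n (\<lambda>g. U #>\<^bsub>G\<^esub> g) \<tau> = \<sigma>"
  proof -
    have "pullback G n (\<lambda>g. U #>\<^bsub>G\<^esub> g) \<tau> g = \<sigma> g" for g
      using eq[of g] cochain unfolding pullback_def
      by (cases "g \<in> tuples G n") (auto simp: cochains_def PiE_def extensional_def simp del: One_nat_def)
    then show ?thesis ..
  qed
  ultimately show ?thesis
    using that U by blast
qed

end

section \<open>Symmetric cohomology of the system of finite quotients\<close>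

theorem theorem6p1:
  fixes G :: "('a, 'm) monoid_scheme" and T :: "'a topology"
    and A :: "('b, 'k) monoid_scheme" and TA :: "'b topology"
    and act :: "'a \<Rightarrow> 'b \<Rightarrow> 'b" and n :: nat
  assumes "profinite_group G T"
    and "discrete_module G T A TA act"
  shows "HSc G T A TA act n \<cong>
    direct_limit (open_normal_subgroups G T) (\<lambda>V U. U \<subseteq> V)
      (quotient_HS G A act n) (transition G A act n)"
proof -
  interpret profinite_group G T by fact
  interpret D: discrete_module G T A TA act by fact
  let ?I = "open_normal_subgroups G T"
  define F where "F = fixed_points A act"
  define q where "q = quotient_act A act"
  define H where "H U = G Mod U" for U
  define C where "C U = cochains (H U) (F U)" for U
  define M where "M U = cochain_group (H U) (F U) n" for U
  define Z where "Z U = carrier (sym_cocycles (H U) (F U) (q U) (C U) n)" for U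
  define B where "B U = sym_coboundaries (H U) (F U) (q U) (C U) n" for U
  define \<iota> :: "'a set \<Rightarrow> ((nat \<Rightarrow> 'a set) \<Rightarrow> 'b) \<Rightarrow> ((nat \<Rightarrow> 'a) \<Rightarrow> 'b)" where "\<iota> U = pullback G n (\<lambda>g. U #>\<^bsub>G\<^esub> g)" for U
  define Cc where "Cc = cont_cochains G T A TA"
  define Zc where "Zc = carrier (sym_cocycles G A act Cc n)"
  define Bc where "Bc = sym_coboundaries G A act Cc n"
  note defs = F_def q_def H_def C_def M_def Z_def B_def \<iota>_def Cc_def Zc_def Bc_def
  have N: "U \<lhd> G" if "U \<in> ?I" for U
    using that by (simp add: open_normal_subgroups_def)
  have pb: "module_pullback G A act (H U) (F U) (q U) (\<lambda>g. U #>\<^bsub>G\<^esub> g)" if "U \<in> ?I" for U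
    unfolding defs using N[OF that] by (rule D.M.quotient_pullback)
  have infl: "module_pullback (H U) (F U) (q U) (H V) (F V) (q V) (\<lambda>Q. V <#>\<^bsub>G\<^esub> Q)"
    if "U \<in> ?I" "V \<in> ?I" "U \<subseteq> V" for U V
    unfolding defs using N that by (intro D.M.inflation_pullback)
  have mod: "G_module (H U) (F U) (q U)" if "U \<in> ?I" for U
    using pb[OF that] by (rule module_pullback.axioms)
  have surj: "(\<lambda>g. U #>\<^bsub>G\<^esub> g) ` carrier G = carrier (H U)" for U
    unfolding defs by (rule carrier_FactGroup[symmetric])
  have C_subgroup: "subgroup (C U m) (cochain_group (H U) (F U) m)" if "U \<in> ?I" for U m
  proof -
    interpret G_module "H U" "F U" "q U"
      using mod[OF that] .
    interpret M: comm_group "cochain_group (H U) (F U) m"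
      by (rule comm_group_cochain_group) unfold_locales
    show ?thesis
      using M.subgroup_self by (simp add: C_def cochain_group_def)
  qed
  have Cc_subgroup: "subgroup (Cc m) (cochain_group G A m)" for m
    unfolding Cc_def by (rule D.subgroup_cont_cochains)
  \<comment> \<open>With \<open>infl_C\<close> below, this provides the two choices of target
    family: continuous cochains on \<open>G\<close> and all cochains on a quotient.\<close>
  have pb_C: "pullback G m (\<lambda>g. U #>\<^bsub>G\<^esub> g) \<sigma> \<in> Cc m" if "U \<in> ?I" "\<sigma> \<in> cochains (H U) (F U) m" for U \<sigma> m
    using that unfolding defs by (rule D.pullback_cont_cochain)
  have infl_C: "pullback (H U) m (\<lambda>Q. V <#>\<^bsub>G\<^esub> Q) \<sigma> \<in> C U m"
    if "U \<in> ?I" "V \<in> ?I" "U \<subseteq> V" "\<sigma> \<in> cochains (H V) (F V) m" for U V \<sigma> m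
    unfolding C_def using module_pullback.pullback_closed[OF infl[OF that(1-3)] that(4)] .
  have Z_sub: "\<sigma> \<in> cochains (H U) (F U) n" if "\<sigma> \<in> Z U" for \<sigma> U
    using that by (simp add: Z_def C_def carrier_sym_cocycles carrier_sym_cochains)
  have "cochain_group G A n\<lparr>carrier := Zc\<rparr> Mod Bc \<cong>
    direct_limit ?I (\<lambda>V U. U \<subseteq> V) (\<lambda>U. M U\<lparr>carrier := Z U\<rparr> Mod B U)
      (\<lambda>V U c. \<Union>\<sigma>\<in>c. B U #>\<^bsub>M U\<lparr>carrier := Z U\<rparr>\<^esub> inflation G n V U \<sigma>)"
  proof (rule subquotient_direct_limit_iso[where \<iota> = \<iota>])
    show "comm_group (cochain_group G A n)"
      by (rule comm_group_cochain_group) unfold_locales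
    show "subgroup Zc (cochain_group G A n)"
      unfolding Zc_def by (rule D.M.subgroup_sym_cocycles[OF Cc_subgroup])
    show "subgroup Bc (cochain_group G A n)"
      unfolding Bc_def by (rule D.M.subgroup_sym_coboundaries[OF Cc_subgroup])
  next
    fix U assume U: "U \<in> ?I"
    interpret U: module_pullback G A act "H U" "F U" "q U" "\<lambda>g. U #>\<^bsub>G\<^esub> g"
      using pb[OF U] .
    show "comm_group (M U)"
      unfolding M_def by (rule comm_group_cochain_group) unfold_locales
    show "subgroup (Z U) (M U)"
      unfolding Z_def M_def by (rule U.H.subgroup_sym_cocycles[OF C_subgroup[OF U]])
    show "subgroup (B U) (M U)"
      unfolding B_def M_def by (rule U.H.subgroup_sym_coboundaries[OF C_subgroup[OF U]])
    show "\<iota> U \<in> hom (M U) (cochain_group G A n)"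
      unfolding \<iota>_def M_def by (rule U.pullback_hom)
    show "inj_on (\<iota> U) (carrier (M U))"
      using U.pullback_inj[OF surj] by (simp add: \<iota>_def M_def cochain_group_def)
    show "\<iota> U ` Z U \<subseteq> Zc"
      using U.pullback_sym_cocycles[of Cc, OF pb_C[OF U]] unfolding \<iota>_def Z_def Zc_def C_def by blast
    show "\<iota> U ` B U \<subseteq> Bc"
      using U.pullback_sym_coboundaries[of Cc, OF pb_C[OF U]] unfolding \<iota>_def B_def Bc_def C_def by blast
  next
    fix V U assume UV: "V \<in> ?I" "U \<in> ?I" "U \<subseteq> V"
    interpret UV: module_pullback "H U" "F U" "q U" "H V" "F V" "q V" "\<lambda>Q. V <#>\<^bsub>G\<^esub> Q"
      using infl UV by blast
    have f_eq: "inflation G n V U = pullback (H U) n (\<lambda>Q. V <#>\<^bsub>G\<^esub> Q)"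
      unfolding H_def by (rule D.M.inflation_eq)
    show "inflation G n V U \<in> hom (M V) (M U)"
      unfolding f_eq M_def by (rule UV.pullback_hom)
    show "inflation G n V U ` Z V \<subseteq> Z U"
      using UV.pullback_sym_cocycles[of "C U", OF infl_C[OF UV(2,1,3)]] unfolding f_eq Z_def C_def by blast
    show "inflation G n V U ` B V \<subseteq> B U"
      using UV.pullback_sym_coboundaries[of "C U", OF infl_C[OF UV(2,1,3)]] unfolding f_eq B_def C_def by blast
    show "\<iota> U (inflation G n V U \<sigma>) = \<iota> V \<sigma>" for \<sigma>
      unfolding \<iota>_def by (rule D.M.pullback_inflation[OF N[OF UV(2)] N[OF UV(1)] UV(3)])
  next
    \<comment> \<open>The order is reverse inclusion, so an upper bound of two levels is their
      intersection.\<close>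
    show "\<exists>U\<in>?I. U \<subseteq> V \<and> U \<subseteq> W" if "V \<in> ?I" "W \<in> ?I" for V W
      using open_normal_subgroups_Int[OF that] by blast
    show "W \<subseteq> V" if "U \<subseteq> V" "W \<subseteq> U" for U V W :: "'a set"
      using that by blast
  next
    fix z assume z: "z \<in> Zc"
    then have "z \<in> cont_cochains G T A TA n"
      by (simp add: Zc_def Cc_def carrier_sym_cocycles carrier_sym_cochains)
    then obtain U \<tau> where U: "U \<in> ?I" "\<tau> \<in> cochains (H U) (F U) n" "\<iota> U \<tau> = z"
      unfolding defs by (rule D.cont_cochain_descends[OF compact])
    \<comment> \<open>The descent produces merely a cochain; symmetry and the cocycle condition are
      recovered from those of its pullback \<open>z\<close>.\<close>
    have "\<tau> \<in> Z U"
      unfolding Z_def C_def using U z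
      by (intro module_pullback.sym_cocycles_of_pullback[OF pb surj]) (simp_all add: \<iota>_def Zc_def)
    then show "\<exists>U\<in>?I. z \<in> \<iota> U ` Z U"
      using U by blast
  next
    fix b assume b: "b \<in> Bc"
    show "\<exists>U\<in>?I. b \<in> \<iota> U ` B U"
    proof (cases n)
      case 0
      \<comment> \<open>In degree \<open>0\<close> only the neutral cochain has to be reached, so
        any level will do, for instance the trivial quotient.\<close>
      interpret U: module_pullback G A act "H (carrier G)" "F (carrier G)" "q (carrier G)"
          "\<lambda>g. carrier G #>\<^bsub>G\<^esub> g"
        using pb[OF carrier_open_normal] .
      have "b = \<iota> (carrier G) \<one>\<^bsub>cochain_group (H (carrier G)) (F (carrier G)) n\<^esub>"
        using b 0 unfolding \<iota>_def U.pullback_one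
        by (simp add: Bc_def sym_coboundaries_def sym_cochains_def cochain_group_def)
      moreover have "\<one>\<^bsub>cochain_group (H (carrier G)) (F (carrier G)) n\<^esub> \<in> B (carrier G)"
        using 0 by (simp add: B_def sym_coboundaries_def sym_cochains_def cochain_group_def)
      ultimately show ?thesis
        using carrier_open_normal by blast
    next
      case (Suc m)
      \<comment> \<open>It is the primitive \<beta> that descends, not \<open>b\<close>: a cochain
        over \<open>G/U\<close> that inflates to \<open>b\<close> would not by itself come with a
        symmetric primitive over \<open>G/U\<close>.\<close>
      then obtain \<beta> where \<beta>: "\<beta> \<in> carrier (sym_cochains G A act Cc m)" "b = coboundary G A act m \<beta>"
        using b by (auto simp: Bc_def sym_coboundaries_def)
      then have "\<beta> \<in> cont_cochains G T A TA m"
        by (simp add: Cc_def carrier_sym_cochains)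
      then obtain U \<tau> where U: "U \<in> ?I" "\<tau> \<in> cochains (H U) (F U) m"
          "pullback G m (\<lambda>g. U #>\<^bsub>G\<^esub> g) \<tau> = \<beta>"
        unfolding defs by (rule D.cont_cochain_descends[OF compact])
      interpret U: module_pullback G A act "H U" "F U" "q U" "\<lambda>g. U #>\<^bsub>G\<^esub> g"
        using pb[OF U(1)] .
      have "\<tau> \<in> carrier (sym_cochains (H U) (F U) (q U) (C U) m)"
        unfolding C_def using U \<beta>(1) by (intro U.sym_cochains_of_pullback[OF surj]) simp_all
      then have "coboundary (H U) (F U) (q U) m \<tau> \<in> B U"
        using Suc by (simp add: B_def sym_coboundaries_def)
      moreover have "\<iota> U (coboundary (H U) (F U) (q U) m \<tau>) = b"
        using U.coboundary_pullback[OF U(2)] U(3) \<beta>(2) Suc by (simp add: \<iota>_def)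
      ultimately show ?thesis
        using U(1) by blast
    qed
  qed
  moreover have "HSc G T A TA act n = cochain_group G A n\<lparr>carrier := Zc\<rparr> Mod Bc"
    unfolding HSc_def sym_cohomology_def Zc_def Bc_def Cc_def sym_cocycles_eq[symmetric] ..
  moreover have "quotient_HS G A act n = (\<lambda>U. M U\<lparr>carrier := Z U\<rparr> Mod B U)"
    unfolding quotient_HS_def HS_def sym_cohomology_def M_def Z_def B_def C_def H_def F_def q_def
      sym_cocycles_eq[symmetric] ..
  moreover have "transition G A act n =
      (\<lambda>V U c. \<Union>\<sigma>\<in>c. B U #>\<^bsub>M U\<lparr>carrier := Z U\<rparr>\<^esub> inflation G n V U \<sigma>)"
    unfolding transition_def Let_def M_def Z_def B_def C_def H_def F_def q_def
      sym_cocycles_eq[symmetric] ..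
  ultimately show ?thesis
    by simp
qed

end
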